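(* Let $\mathbf{Y}$ be a set, for each $Y\in\mathbf{Y}$ let $\mathcal{C}(Y)$ be a geodesic metric space, and let $\pi_Y$ be a function assigning to each element of $\mathbf{Y}\setminus\{Y\}$ a subset of $\mathcal{C}(Y)$. If $\{(\mathcal{C}(Y),\pi_Y)\}_{Y\in\mathbf{Y}}$ satisfies Axioms (0), (3) and (4), then $\mathcal{C}(\{(\mathcal{C}(Y),\pi_Y)\}_{Y\in\mathbf{Y}})$ is hyperbolic relative to $\{\mathcal{C}(Y)\}_{Y\in\mathbf{Y}}$.
   Context: **Axioms (Bestvina-Bromberg-Fujiwara).** For $Y\in\mathbf{Y}$ and $X,Z\in\mathbf{Y}\setminus\{Y\}$ put $D_Y(X,Z)=diam(\pi_Y(X)\cup\pi_Y(Z))$. (0) $diam(\pi_Y(X))<+\infty$ for all $X\ne Y$; (3) there exists $\xi$ so that $\min\{D_Y(X,Z),D_Z(X,Y)\}\le\xi$ for all distinct $X,Y,Z$; (4) there exists $\xi$ so that $\{Y: D_Y(X,Z)\ge\xi\}$ is a finite set for each $X,Z\in\mathbf{Y}$. Fix a single $\xi$ that works in (3) and (4). **The modified distance.** $d^\pi_Y$ denotes the function defined by Bestvina-Bromberg-Fujiwara, which satisfies $|d^\pi_Y(X,Z)-D_Y(X,Z)|\le2\xi$: for $X\neq Z$ let $\mathcal{H}(X,Z)$ be the set of pairs $(X',Z')$ of distinct elements of $\mathbf{Y}$ such that one of the following holds: both $D_X(X',Z')>2\xi$ and $D_Z(X',Z')>2\xi$; or $X'=X$ and $D_Z(X,Z')>2\xi$;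 or $Z'=Z$ and $D_X(X',Z)>2\xi$; or $(X',Z')=(X,Z)$. Then $d^\pi_Y(X,Z)=\inf D_Y(X',Z')$ over $(X',Z')\in\mathcal{H}(X,Z)$ with $X',Z'\ne Y$. **The space.** For a suitably chosen (large) constant $K$ depending on $\xi$, let $\mathcal{P}_K$ be the graph with vertex set $\mathbf{Y}$ in which $X\ne Z$ are joined by an edge iff $d^\pi_Y(X,Z)\le K$ for each $Y\in\mathbf{Y}\setminus\{X,Z\}$. $\mathcal{C}(\{(\mathcal{C}(Y),\pi_Y)\}_{Y\in\mathbf{Y}})$ is the path metric space consisting of the disjoint union of all the $\mathcal{C}(Y)$ together with edges of length $1$ connecting all points in $\pi_X(Z)$ to all points in $\pi_Z(X)$ whenever $X,Z$ are connected by an edge in $\mathcal{P}_K$. **Relative hyperbolicity.** Let $(S,d)$ be a geodesic metric space and $\mathcal{P}$ a collection of subsets; $N_K(A)=\{x:d(x,A)\le K\}$; an almost-geodesic is a continuous quasi-geodesic. $(\alpha_1)$: for each $K$ there is $B$ with $diam(N_K(P)\cap N_K(Q))\le B$ for all distinct $P,Q\in\mathcal{P}$. $(\alpha_2)$: there are $\epsilon\in(0,1/2)$, $M\ge0$ such that for each $P\in\mathcal{P}$ and $x,y\in N_{\epsilon d(x,y)}(P)$, any geodesic from $x$ to $y$ intersects $N_M(P)$. $S$ is $( * )$-asymptotically tree-graded with respect to $\mathcal{P}$ if for every $C\ge0$ there are $\sigma,\delta$ such that every triangle with $(1,C)$-almost-geodesic sides $\gamma_1,\gamma_2,\gamma_3$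 satisfies either (C) some ball of radius $\sigma$ intersects all sides, or (P) there is $P\in\mathcal{P}$ such that $N_\sigma(P)$ intersects all sides and the entrance points $x_i$ and exit points $y_i$ of $\gamma_i$ in/from $N_\sigma(P)$ satisfy $d(y_i,x_{i+1})\le\delta$ (indices mod 3, sides oriented cyclically). $S$ is hyperbolic relative to $\mathcal{P}$ if $(\alpha_1)$, $(\alpha_2)$ hold and $S$ is $( * )$-asymptotically tree-graded with respect to $\mathcal{P}$.
   Formalization: The constructed space need not be geodesic (e.g. if projections are not closed), so it is shown to be a path metric space satisfying (α1), (α2) and the ( * )-condition, without geodesicity; projections are assumed nonempty so that the space is connected. *)

theory Defs
  imports "HOL-Analysis.Analysis"
begin

section \<open>Metric notions\<close>

text \<open>The diameter takes values in $[0,\infty]$; the inserted 0 only serves to give the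
  empty set diameter 0 instead of the bottom element of the extended reals.\<close>

definition mdiam :: "'p metric \<Rightarrow> 'p set \<Rightarrow> ereal" where
  "mdiam m A = Sup (insert 0 ((\<lambda>(x, y). ereal (mdist m x y)) ` (A \<times> A)))"

text \<open>The guard reflects $d(x,\emptyset) = \infty$.\<close>

definition nbhd :: "'p metric \<Rightarrow> real \<Rightarrow> 'p set \<Rightarrow> 'p set" where
  "nbhd m r A = {x \<in> mspace m. A \<noteq> {} \<and> (INF a\<in>A. mdist m x a) \<le> r}"

text \<open>Paths are functions on a real interval \<open>{0..l}\<close>; their values elsewhere are irrelevant.\<close>

definition geodesic_path :: "'p metric \<Rightarrow> real \<Rightarrow> (real \<Rightarrow> 'p) \<Rightarrow> bool" where
  "geodesic_path m l \<gamma> \<longleftrightarrow> 0 \<le> l \<and> \<gamma> ` {0..l} \<subseteq> mspace m \<and>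
     (\<forall>s\<in>{0..l}. \<forall>t\<in>{0..l}. mdist m (\<gamma> s) (\<gamma> t) = \<bar>s - t\<bar>)"

definition geodesic_metric :: "'p metric \<Rightarrow> bool" where
  "geodesic_metric m \<longleftrightarrow> (\<forall>x\<in>mspace m. \<forall>y\<in>mspace m.
     \<exists>l \<gamma>. geodesic_path m l \<gamma> \<and> \<gamma> 0 = x \<and> \<gamma> l = y)"

text \<open>A path metric (length metric): the distance is the infimum of the lengths of
  rectifiable paths. A path of length at most \<open>l\<close> is the same thing, up to
  reparametrisation, as a 1-Lipschitz map on \<open>{0..l}\<close>.\<close>

definition path_metric :: "'p metric \<Rightarrow> bool" where
  "path_metric m \<longleftrightarrow> (\<forall>x\<in>mspace m. \<forall>y\<in>mspace m. \<forall>e>0. \<exists>l \<gamma>.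
     0 \<le> l \<and> l < mdist m x y + e \<and> \<gamma> 0 = x \<and> \<gamma> l = y \<and> \<gamma> ` {0..l} \<subseteq> mspace m \<and>
     (\<forall>s\<in>{0..l}. \<forall>t\<in>{0..l}. mdist m (\<gamma> s) (\<gamma> t) \<le> \<bar>s - t\<bar>))"

definition quasi_geodesic :: "'p metric \<Rightarrow> real \<Rightarrow> real \<Rightarrow> real \<Rightarrow> (real \<Rightarrow> 'p) \<Rightarrow> bool" where
  "quasi_geodesic m \<mu> C l \<gamma> \<longleftrightarrow> 0 \<le> l \<and> \<gamma> ` {0..l} \<subseteq> mspace m \<and>
     (\<forall>s\<in>{0..l}. \<forall>t\<in>{0..l}. \<bar>s - t\<bar> / \<mu> - C \<le> mdist m (\<gamma> s) (\<gamma> t)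
                          \<and> mdist m (\<gamma> s) (\<gamma> t) \<le> \<mu> * \<bar>s - t\<bar> + C)"

definition almost_geodesic :: "'p metric \<Rightarrow> real \<Rightarrow> real \<Rightarrow> real \<Rightarrow> (real \<Rightarrow> 'p) \<Rightarrow> bool" where
  "almost_geodesic m \<mu> C l \<gamma> \<longleftrightarrow> quasi_geodesic m \<mu> C l \<gamma> \<and>
     continuous_map (top_of_set {0..l}) (mtopology_of m) \<gamma>"

section \<open>Relative hyperbolicity\<close>

definition alpha1 :: "'p metric \<Rightarrow> 'p set set \<Rightarrow> bool" where
  "alpha1 m \<P> \<longleftrightarrow> (\<forall>r::real. \<exists>B::real. \<forall>P\<in>\<P>. \<forall>Q\<in>\<P>. P \<noteq> Q \<longrightarrow>
     mdiam m (nbhd m r P \<inter> nbhd m r Q) \<le> ereal B)"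

definition alpha2 :: "'p metric \<Rightarrow> 'p set set \<Rightarrow> bool" where
  "alpha2 m \<P> \<longleftrightarrow> (\<exists>\<epsilon>::real. \<exists>M::real. 0 < \<epsilon> \<and> \<epsilon> < 1/2 \<and> 0 \<le> M \<and>
     (\<forall>P\<in>\<P>. \<forall>x y. x \<in> nbhd m (\<epsilon> * mdist m x y) P \<and> y \<in> nbhd m (\<epsilon> * mdist m x y) P \<longrightarrow>
        (\<forall>l \<gamma>. geodesic_path m l \<gamma> \<and> \<gamma> 0 = x \<and> \<gamma> l = y \<longrightarrow>
           \<gamma> ` {0..l} \<inter> nbhd m M P \<noteq> {})))"

text \<open>First and last point of a path in a set. They are used only for continuous paths that
  meet the set, which is a (closed) neighbourhood, so that the extremal times are attained.\<close>

definition entrance_point :: "real \<Rightarrow> (real \<Rightarrow> 'p) \<Rightarrow> 'p set \<Rightarrow> 'p" where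
  "entrance_point l \<gamma> A = \<gamma> (Inf {t \<in> {0..l}. \<gamma> t \<in> A})"

definition exit_point :: "real \<Rightarrow> (real \<Rightarrow> 'p) \<Rightarrow> 'p set \<Rightarrow> 'p" where
  "exit_point l \<gamma> A = \<gamma> (Sup {t \<in> {0..l}. \<gamma> t \<in> A})"

definition asymp_tree_graded :: "'p metric \<Rightarrow> 'p set set \<Rightarrow> bool" where
  "asymp_tree_graded m \<P> \<longleftrightarrow> (\<forall>C\<ge>0. \<exists>\<sigma> \<delta> :: real. \<forall>l\<^sub>1 l\<^sub>2 l\<^sub>3 \<gamma>\<^sub>1 \<gamma>\<^sub>2 \<gamma>\<^sub>3.
     almost_geodesic m 1 C l\<^sub>1 \<gamma>\<^sub>1 \<and> almost_geodesic m 1 C l\<^sub>2 \<gamma>\<^sub>2 \<and> almost_geodesic m 1 C l\<^sub>3 \<gamma>\<^sub>3 \<and>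
     \<gamma>\<^sub>1 l\<^sub>1 = \<gamma>\<^sub>2 0 \<and> \<gamma>\<^sub>2 l\<^sub>2 = \<gamma>\<^sub>3 0 \<and> \<gamma>\<^sub>3 l\<^sub>3 = \<gamma>\<^sub>1 0 \<longrightarrow>
     (\<exists>a\<in>mspace m. \<gamma>\<^sub>1 ` {0..l\<^sub>1} \<inter> mball_of m a \<sigma> \<noteq> {} \<and>
                   \<gamma>\<^sub>2 ` {0..l\<^sub>2} \<inter> mball_of m a \<sigma> \<noteq> {} \<and>
                   \<gamma>\<^sub>3 ` {0..l\<^sub>3} \<inter> mball_of m a \<sigma> \<noteq> {})
     \<or> (\<exists>P\<in>\<P>. let N = nbhd m \<sigma> P in
          \<gamma>\<^sub>1 ` {0..l\<^sub>1} \<inter> N \<noteq> {} \<and> \<gamma>\<^sub>2 ` {0..l\<^sub>2} \<inter> N \<noteq> {} \<and> \<gamma>\<^sub>3 ` {0..l\<^sub>3} \<inter> N \<noteq> {} \<and>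
          mdist m (exit_point l\<^sub>1 \<gamma>\<^sub>1 N) (entrance_point l\<^sub>2 \<gamma>\<^sub>2 N) \<le> \<delta> \<and>
          mdist m (exit_point l\<^sub>2 \<gamma>\<^sub>2 N) (entrance_point l\<^sub>3 \<gamma>\<^sub>3 N) \<le> \<delta> \<and>
          mdist m (exit_point l\<^sub>3 \<gamma>\<^sub>3 N) (entrance_point l\<^sub>1 \<gamma>\<^sub>1 N) \<le> \<delta>))"

text \<open>The ambient space is not required to be geodesic here: the spaces built below are path
  metric spaces, but infima of path lengths need not be attained when the projections
  are not closed. For geodesic spaces this is the usual notion.\<close>

definition hyperbolic_relative :: "'p metric \<Rightarrow> 'p set set \<Rightarrow> bool" where
  "hyperbolic_relative m \<P> \<longleftrightarrow> alpha1 m \<P> \<and> alpha2 m \<P> \<and> asymp_tree_graded m \<P>"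

section \<open>Projection systems\<close>

text \<open>\<open>Y\<close> is the index set, \<open>C X\<close> the space attached to \<open>X \<in> Y\<close>, and \<open>p X Z\<close> the projection
  $\pi_X(Z)$, which is meaningful only for \<open>X \<noteq> Z\<close>. Projections are nonempty: otherwise the
  space built from the system may be disconnected.\<close>

definition projection_system ::
  "'i set \<Rightarrow> ('i \<Rightarrow> 'a metric) \<Rightarrow> ('i \<Rightarrow> 'i \<Rightarrow> 'a set) \<Rightarrow> bool" where
  "projection_system Y C p \<longleftrightarrow> (\<forall>X\<in>Y. geodesic_metric (C X)) \<and>
     (\<forall>X\<in>Y. \<forall>Z\<in>Y. X \<noteq> Z \<longrightarrow> p X Z \<noteq> {} \<and> p X Z \<subseteq> mspace (C X))"

text \<open>\<open>proj_dist C p W X Z\<close> is $D_W(X,Z)$.\<close>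

definition proj_dist ::
  "('i \<Rightarrow> 'a metric) \<Rightarrow> ('i \<Rightarrow> 'i \<Rightarrow> 'a set) \<Rightarrow> 'i \<Rightarrow> 'i \<Rightarrow> 'i \<Rightarrow> ereal" where
  "proj_dist C p W X Z = mdiam (C W) (p W X \<union> p W Z)"

definition axiom0 :: "'i set \<Rightarrow> ('i \<Rightarrow> 'a metric) \<Rightarrow> ('i \<Rightarrow> 'i \<Rightarrow> 'a set) \<Rightarrow> bool" where
  "axiom0 Y C p \<longleftrightarrow> (\<forall>W\<in>Y. \<forall>X\<in>Y. X \<noteq> W \<longrightarrow> mdiam (C W) (p W X) < \<infinity>)"

definition axiom3 :: "'i set \<Rightarrow> ('i \<Rightarrow> 'a metric) \<Rightarrow> ('i \<Rightarrow> 'i \<Rightarrow> 'a set) \<Rightarrow> real \<Rightarrow> bool" where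
  "axiom3 Y C p \<xi> \<longleftrightarrow> (\<forall>X\<in>Y. \<forall>W\<in>Y. \<forall>Z\<in>Y. X \<noteq> W \<and> W \<noteq> Z \<and> X \<noteq> Z \<longrightarrow>
     min (proj_dist C p W X Z) (proj_dist C p Z X W) \<le> ereal \<xi>)"

definition axiom4 :: "'i set \<Rightarrow> ('i \<Rightarrow> 'a metric) \<Rightarrow> ('i \<Rightarrow> 'i \<Rightarrow> 'a set) \<Rightarrow> real \<Rightarrow> bool" where
  "axiom4 Y C p \<xi> \<longleftrightarrow> (\<forall>X\<in>Y. \<forall>Z\<in>Y. finite {W \<in> Y - {X, Z}. ereal \<xi> \<le> proj_dist C p W X Z})"

text \<open>The pairs $\mathcal{H}(X,Z)$. The inequations among indices say that the projection
  distances involved are defined.\<close>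

definition H_pairs ::
  "'i set \<Rightarrow> ('i \<Rightarrow> 'a metric) \<Rightarrow> ('i \<Rightarrow> 'i \<Rightarrow> 'a set) \<Rightarrow> real \<Rightarrow> 'i \<Rightarrow> 'i \<Rightarrow> ('i \<times> 'i) set" where
  "H_pairs Y C p \<xi> X Z = {(X', Z'). X' \<in> Y \<and> Z' \<in> Y \<and> X' \<noteq> Z' \<and>
     ((X' \<notin> {X, Z} \<and> Z' \<notin> {X, Z} \<and>
         ereal (2 * \<xi>) < proj_dist C p X X' Z' \<and> ereal (2 * \<xi>) < proj_dist C p Z X' Z')
      \<or> (X' = X \<and> Z' \<noteq> Z \<and> ereal (2 * \<xi>) < proj_dist C p Z X Z')
      \<or> (Z' = Z \<and> X' \<noteq> X \<and> ereal (2 * \<xi>) < proj_dist C p X X' Z)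
      \<or> (X' = X \<and> Z' = Z))}"

text \<open>\<open>mod_dist Y C p \<xi> W X Z\<close> is $d^\pi_W(X,Z)$, for \<open>X \<noteq> Z\<close> and \<open>W \<notin> {X, Z}\<close>.\<close>

definition mod_dist ::
  "'i set \<Rightarrow> ('i \<Rightarrow> 'a metric) \<Rightarrow> ('i \<Rightarrow> 'i \<Rightarrow> 'a set) \<Rightarrow> real \<Rightarrow> 'i \<Rightarrow> 'i \<Rightarrow> 'i \<Rightarrow> ereal" where
  "mod_dist Y C p \<xi> W X Z =
     (INF (X', Z') \<in> {(X', Z') \<in> H_pairs Y C p \<xi> X Z. X' \<noteq> W \<and> Z' \<noteq> W}. proj_dist C p W X' Z')"

definition PK_edge ::
  "'i set \<Rightarrow> ('i \<Rightarrow> 'a metric) \<Rightarrow> ('i \<Rightarrow> 'i \<Rightarrow> 'a set) \<Rightarrow> real \<Rightarrow> real \<Rightarrow> 'i \<Rightarrow> 'i \<Rightarrow> bool" where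
  "PK_edge Y C p \<xi> K X Z \<longleftrightarrow> X \<in> Y \<and> Z \<in> Y \<and> X \<noteq> Z \<and>
     (\<forall>W \<in> Y - {X, Z}. mod_dist Y C p \<xi> W X Z \<le> ereal K)"

section \<open>The space built from a projection system\<close>

text \<open>A point is encoded by its barycentric weights on the disjoint union of the \<open>C X\<close>, whose
  elements are pairs \<open>(X, x)\<close>: the point \<open>x\<close> of \<open>C X\<close> has weight 1 at \<open>(X, x)\<close>, and the point at
  parameter \<open>t\<close> on the edge from \<open>u\<close> to \<open>v\<close> has weights \<open>1 - t\<close> at \<open>u\<close> and \<open>t\<close> at \<open>v\<close>. Thus
  distinct edges are disjoint apart from end points, and the edges from \<open>u\<close> to \<open>v\<close> and from
  \<open>v\<close> to \<open>u\<close> are the same.\<close>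

type_synonym ('i, 'a) point = "'i \<times> 'a \<Rightarrow> real"

definition space_point :: "'i \<Rightarrow> 'a \<Rightarrow> ('i, 'a) point" where
  "space_point X x = indicator {(X, x)}"

definition edge_point :: "'i \<times> 'a \<Rightarrow> 'i \<times> 'a \<Rightarrow> real \<Rightarrow> ('i, 'a) point" where
  "edge_point u v t = (\<lambda>w. (1 - t) * indicator {u} w + t * indicator {v} w)"

definition piece :: "('i \<Rightarrow> 'a metric) \<Rightarrow> 'i \<Rightarrow> ('i, 'a) point set" where
  "piece C X = space_point X ` mspace (C X)"

definition BBF_edge ::
  "'i set \<Rightarrow> ('i \<Rightarrow> 'a metric) \<Rightarrow> ('i \<Rightarrow> 'i \<Rightarrow> 'a set) \<Rightarrow> real \<Rightarrow> real
    \<Rightarrow> 'i \<times> 'a \<Rightarrow> 'i \<times> 'a \<Rightarrow> bool" where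
  "BBF_edge Y C p \<xi> K u v \<longleftrightarrow> PK_edge Y C p \<xi> K (fst u) (fst v) \<and>
     snd u \<in> p (fst u) (fst v) \<and> snd v \<in> p (fst v) (fst u)"

definition BBF_points ::
  "'i set \<Rightarrow> ('i \<Rightarrow> 'a metric) \<Rightarrow> ('i \<Rightarrow> 'i \<Rightarrow> 'a set) \<Rightarrow> real \<Rightarrow> real \<Rightarrow> ('i, 'a) point set" where
  "BBF_points Y C p \<xi> K = (\<Union>X\<in>Y. piece C X) \<union>
     {edge_point u v t | u v t. BBF_edge Y C p \<xi> K u v \<and> t \<in> {0..1}}"

text \<open>\<open>chain Y C p \<xi> K x y L\<close>: there is a finite chain of points from \<open>x\<close> to \<open>y\<close> in which any two
  consecutive points lie in a common \<open>C X\<close> or on a common closed edge, and the distances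
  within these pieces add up to \<open>L\<close>. As the pieces are geodesic, such a chain amounts to a path of
  length \<open>L\<close>.\<close>

inductive chain ::
  "'i set \<Rightarrow> ('i \<Rightarrow> 'a metric) \<Rightarrow> ('i \<Rightarrow> 'i \<Rightarrow> 'a set) \<Rightarrow> real \<Rightarrow> real
    \<Rightarrow> ('i, 'a) point \<Rightarrow> ('i, 'a) point \<Rightarrow> real \<Rightarrow> bool"
  for Y C p \<xi> K where
  refl: "x \<in> BBF_points Y C p \<xi> K \<Longrightarrow> chain Y C p \<xi> K x x 0"
| in_space: "\<lbrakk>chain Y C p \<xi> K x (space_point X a) L; X \<in> Y; a \<in> mspace (C X); b \<in> mspace (C X)\<rbrakk>
    \<Longrightarrow> chain Y C p \<xi> K x (space_point X b) (L + mdist (C X) a b)"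
| in_edge: "\<lbrakk>chain Y C p \<xi> K x (edge_point u v s) L; BBF_edge Y C p \<xi> K u v; s \<in> {0..1}; t \<in> {0..1}\<rbrakk>
    \<Longrightarrow> chain Y C p \<xi> K x (edge_point u v t) (L + \<bar>s - t\<bar>)"

definition BBF_dist ::
  "'i set \<Rightarrow> ('i \<Rightarrow> 'a metric) \<Rightarrow> ('i \<Rightarrow> 'i \<Rightarrow> 'a set) \<Rightarrow> real \<Rightarrow> real
    \<Rightarrow> ('i, 'a) point \<Rightarrow> ('i, 'a) point \<Rightarrow> real" where
  "BBF_dist Y C p \<xi> K x y =
     (if x \<in> BBF_points Y C p \<xi> K \<and> y \<in> BBF_points Y C p \<xi> K
      then Inf {L. chain Y C p \<xi> K x y L} else 0)"

text \<open>The type \<open>metric\<close> is total, so this is meaningful only once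
  \<open>Metric_space (BBF_points Y C p \<xi> K) (BBF_dist Y C p \<xi> K)\<close> is known.\<close>

definition BBF_space ::
  "'i set \<Rightarrow> ('i \<Rightarrow> 'a metric) \<Rightarrow> ('i \<Rightarrow> 'i \<Rightarrow> 'a set) \<Rightarrow> real \<Rightarrow> real \<Rightarrow> ('i, 'a) point metric" where
  "BBF_space Y C p \<xi> K = metric (BBF_points Y C p \<xi> K, BBF_dist Y C p \<xi> K)"

end

theory Submission
  imports Defs
begin

text \<open>
  Say that \<open>V\<close> bars \<open>X\<close> from \<open>W\<close> if \<open>V = X\<close> or \<open>D V X W\<close> is large. Two indices with a common
  barrier from \<open>W\<close> have close projections to \<open>W\<close>, by Axiom (3). If consecutive terms of a sequence
  of indices have common barriers from \<open>W\<close> then so do its two ends, with a loss that does not depend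
  on the length. Since a path far from the piece of \<open>W\<close> crosses only edges whose two indices have a
  common barrier, its ends have close projections to \<open>W\<close> and a common barrier. The projections to a
  piece are coarsely Lipschitz, which then gives $(\alpha_1)$ and $(\alpha_2)$.
  For a triangle, a centre \<open>W\<close> is obtained by moving from one vertex towards the opposite side: as
  long as that side stays far from \<open>W\<close> it has a barrier, which replaces \<open>W\<close>. All three sides meet a
  fixed neighbourhood of the piece of \<open>W\<close>, and entrance and exit points are close to the projections
  of the vertices, so alternative (P) always holds.
\<close>

section \<open>Projection distances\<close>

text \<open>The thresholds are fixed backwards. Replacing an end of a pair by an index in between
  needs 4 * r, and \<open>D\<close> exceeds \<open>dmod\<close> by up to 2 * r, so centres are found
  with barriers of strength 6 * r. Joining barriers along a sequence costs 2 * r, so a single edge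
  has to provide 8 * r. Where an edge provides none, one of its ends reaches the piece of
  \<open>W\<close> through at most one further piece, within 9 * r + 2; this argument compares
  \<open>K\<close> with 8 * r + 4 * r, whence K \<ge> 12 * r. Projection distances obey their order
  relations only up to errors, which an induction over indices would accumulate. The modified
  distance removes them: it decreases exactly when an end is replaced by an index in between, so the
  finite sets \<open>T\<close> shrink strictly and serve as induction measures, for connectedness as
  well as for the search of a centre. Axiom (0) gives no uniform bound on the diameters of the sets
  \<open>p W X\<close>. Uniform estimates therefore come from common barriers, from adjacency of
  indices, or from choosing one projection point for each index.\<close>

lemma mdiam_nonneg: "0 \<le> mdiam m A"
  unfolding mdiam_def by (rule Sup_upper) auto

lemma mdist_le_mdiam:
  assumes "a \<in> A" "b \<in> A"
  shows "ereal (mdist m a b) \<le> mdiam m A"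
  unfolding mdiam_def using assms by (intro Sup_upper) auto

lemma mdiam_le:
  assumes "0 \<le> B" "\<And>a b. a \<in> A \<Longrightarrow> b \<in> A \<Longrightarrow> mdist m a b \<le> B"
  shows "mdiam m A \<le> ereal B"
  unfolding mdiam_def using assms by (intro Sup_least) auto

lemma mdist_triangle:
  "x \<in> mspace m \<Longrightarrow> y \<in> mspace m \<Longrightarrow> z \<in> mspace m \<Longrightarrow> mdist m x z \<le> mdist m x y + mdist m y z"
  by (rule Metric_space.triangle[OF Metric_space_mspace_mdist])

lemma mdist_sym: "mdist m x y = mdist m y x"
  by (rule Metric_space.commute[OF Metric_space_mspace_mdist])

lemma mdiam_Un_finite:
  assumes "A \<subseteq> mspace m" "B \<subseteq> mspace m" "mdiam m A < \<infinity>" "mdiam m B < \<infinity>"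
  shows "mdiam m (A \<union> B) < \<infinity>"
proof (cases "A = {} \<or> B = {}")
  case True
  then show ?thesis using assms by auto
next
  case False
  then obtain a b where ab: "a \<in> A" "b \<in> B" by auto
  obtain r s where r: "mdiam m A = ereal r" and s: "mdiam m B = ereal s"
    using assms(3,4) mdiam_nonneg[of m A] mdiam_nonneg[of m B]
    by (cases "mdiam m A"; cases "mdiam m B") auto
  have rs: "0 \<le> r" "0 \<le> s"
    using mdiam_nonneg[of m A] mdiam_nonneg[of m B] r s by auto
  have A: "mdist m x y \<le> r" if "x \<in> A" "y \<in> A" for x y
    using mdist_le_mdiam[OF that, of m] r by simp
  have B: "mdist m x y \<le> s" if "x \<in> B" "y \<in> B" for x y
    using mdist_le_mdiam[OF that, of m] s by simp
  have AB: "mdist m x y \<le> r + mdist m a b + s" if "x \<in> A" "y \<in> B" for x y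
    using mdist_triangle[of x m a y] mdist_triangle[of a m b y] A[of x a] B[of b y] ab that assms(1,2)
    by fastforce
  have "mdist m x y \<le> r + mdist m a b + s" if "x \<in> A \<union> B" "y \<in> A \<union> B" for x y
    using that A[of x y] B[of x y] AB[of x y] AB[of y x] rs mdist_sym[of m x y] mdist_nonneg[of m a b]
    by (smt (verit) Un_iff)
  then have "mdiam m (A \<union> B) \<le> ereal (r + mdist m a b + s)"
    using rs mdist_nonneg[of m a b] by (intro mdiam_le) auto
  then show ?thesis by (rule le_less_trans) simp
qed

lemma mdiam_Un_triangle:
  assumes "A \<subseteq> mspace m" "B \<subseteq> mspace m" "C \<subseteq> mspace m" "B \<noteq> {}"
    and "mdiam m (A \<union> B) \<le> ereal r" "mdiam m (B \<union> C) \<le> ereal s"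
  shows "mdiam m (A \<union> C) \<le> ereal (r + s)"
proof -
  obtain b where b: "b \<in> B" using assms(4) by auto
  have r: "mdist m x y \<le> r" if "x \<in> A \<union> B" "y \<in> A \<union> B" for x y
    using mdist_le_mdiam[OF that, of m] assms(5) by (meson ereal_less_eq(3) order_trans)
  have s: "mdist m x y \<le> s" if "x \<in> B \<union> C" "y \<in> B \<union> C" for x y
    using mdist_le_mdiam[OF that, of m] assms(6) by (meson ereal_less_eq(3) order_trans)
  have rs: "0 \<le> r" "0 \<le> s"
    using order_trans[OF mdist_nonneg r[of b b]] order_trans[OF mdist_nonneg s[of b b]] b by auto
  have AC: "mdist m x y \<le> r + s" if "x \<in> A" "y \<in> C" for x y
    using mdist_triangle[of x m b y] r[of x b] s[of b y] b that assms(1-3) by fastforce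
  show ?thesis
  proof (rule mdiam_le)
    fix x y assume "x \<in> A \<union> C" "y \<in> A \<union> C"
    then show "mdist m x y \<le> r + s"
      using r[of x y] s[of x y] AC[of x y] AC[of y x] rs mdist_sym[of m x y] by fastforce
  qed (use rs in simp)
qed

locale proj_sys =
  fixes Y :: "'i set" and C :: "'i \<Rightarrow> 'a metric" and p :: "'i \<Rightarrow> 'i \<Rightarrow> 'a set" and \<xi> K :: real
  assumes system: "projection_system Y C p"
    and ax0: "axiom0 Y C p" and ax3: "axiom3 Y C p \<xi>" and ax4: "axiom4 Y C p \<xi>"
    and K: "12 * max \<xi> 0 \<le> K"
begin

text \<open>A negative \<open>\<xi>\<close> is possible, but only if there are at most two indices.\<close>

definition r :: real where "r = max \<xi> 0"

definition D :: "'i \<Rightarrow> 'i \<Rightarrow> 'i \<Rightarrow> real" where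
  "D V X Z = real_of_ereal (proj_dist C p V X Z)"

definition dmod :: "'i \<Rightarrow> 'i \<Rightarrow> 'i \<Rightarrow> ereal" where
  "dmod V X Z = mod_dist Y C p \<xi> V X Z"

abbreviation E :: "'i \<Rightarrow> 'i \<Rightarrow> bool" where
  "E X Z \<equiv> PK_edge Y C p \<xi> K X Z"

lemma r_nonneg: "0 \<le> r" and K_ge: "12 * r \<le> K"
  using K by (auto simp: r_def)

lemma p_nonempty: "X \<in> Y \<Longrightarrow> Z \<in> Y \<Longrightarrow> X \<noteq> Z \<Longrightarrow> p X Z \<noteq> {}"
  and p_subset: "X \<in> Y \<Longrightarrow> Z \<in> Y \<Longrightarrow> X \<noteq> Z \<Longrightarrow> p X Z \<subseteq> mspace (C X)"
  using system unfolding projection_system_def by auto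

lemma proj_dist_eq:
  assumes "V \<in> Y" "X \<in> Y" "Z \<in> Y" "V \<noteq> X" "V \<noteq> Z"
  shows "proj_dist C p V X Z = ereal (D V X Z)"
proof -
  have "mdiam (C V) (p V X \<union> p V Z) < \<infinity>"
    using assms ax0 p_subset unfolding axiom0_def by (intro mdiam_Un_finite) auto
  then show ?thesis
    using mdiam_nonneg[of "C V" "p V X \<union> p V Z"] unfolding D_def proj_dist_def
    by (cases "mdiam (C V) (p V X \<union> p V Z)") auto
qed

lemma D_sym: "D V X Z = D V Z X"
  by (simp add: D_def proj_dist_def Un_commute)

lemma D_nonneg: "0 \<le> D V X Z"
  unfolding D_def proj_dist_def by (simp add: mdiam_nonneg real_of_ereal_pos)

lemma mdist_le_D:
  assumes "V \<in> Y" "X \<in> Y" "Z \<in> Y" "V \<noteq> X" "V \<noteq> Z" "a \<in> p V X \<union> p V Z" "b \<in> p V X \<union> p V Z"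
  shows "mdist (C V) a b \<le> D V X Z"
  using mdist_le_mdiam[OF assms(6,7), of "C V"] proj_dist_eq[OF assms(1-5)] by (simp add: proj_dist_def)

lemma D_triangle:
  assumes "V \<in> Y" "X \<in> Y" "U \<in> Y" "Z \<in> Y" "V \<noteq> X" "V \<noteq> U" "V \<noteq> Z"
  shows "D V X Z \<le> D V X U + D V U Z"
proof -
  have "mdiam (C V) (p V X \<union> p V Z) \<le> ereal (D V X U + D V U Z)"
    using assms p_subset p_nonempty proj_dist_eq[of V X U] proj_dist_eq[of V U Z]
    by (intro mdiam_Un_triangle[where B = "p V U"]) (auto simp: proj_dist_def)
  then show ?thesis
    using proj_dist_eq[of V X Z] assms by (simp add: proj_dist_def)
qed

lemma ax3_real:
  assumes "X \<in> Y" "V \<in> Y" "Z \<in> Y" "X \<noteq> V" "V \<noteq> Z" "X \<noteq> Z"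
  shows "D V X Z \<le> \<xi> \<or> D Z X V \<le> \<xi>"
proof -
  have "min (proj_dist C p V X Z) (proj_dist C p Z X V) \<le> ereal \<xi>"
    using ax3 assms unfolding axiom3_def by blast
  then show ?thesis
    using proj_dist_eq[of V X Z] proj_dist_eq[of Z X V] assms by (auto simp: min_def split: if_splits)
qed

text \<open>Axiom (3) makes one of two nonnegative numbers at most \<xi>, so three indices exclude a
  negative \<xi>.\<close>

lemma three_distinct:
  assumes "X \<in> Y" "V \<in> Y" "Z \<in> Y" "X \<noteq> V" "V \<noteq> Z" "X \<noteq> Z"
  shows "r = \<xi>"
  using ax3_real[OF assms] D_nonneg[of V X Z] D_nonneg[of Z X V] unfolding r_def by linarith

text \<open>The working form of Axiom (3): an index that sees two others far apart lies between
  them, and each of these sees the remaining two as close.\<close>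

lemma behrstock:
  assumes "r < D V X Z" "X \<in> Y" "V \<in> Y" "Z \<in> Y" "X \<noteq> V" "V \<noteq> Z" "X \<noteq> Z"
  shows "D Z X V \<le> r" "D Z V X \<le> r" "D X Z V \<le> r" "D X V Z \<le> r"
  using ax3_real[of X V Z] ax3_real[of Z V X] assms three_distinct[of X V Z] D_sym[of V X Z]
    D_sym[of Z X V] D_sym[of X Z V] by auto

lemma finite_D_ge:
  assumes "X \<in> Y" "Z \<in> Y"
  shows "finite {V \<in> Y - {X, Z}. r \<le> D V X Z}"
proof -
  have "{V \<in> Y - {X, Z}. r \<le> D V X Z} \<subseteq> {V \<in> Y - {X, Z}. ereal \<xi> \<le> proj_dist C p V X Z}"
    using proj_dist_eq assms by (auto simp: r_def)
  then show ?thesis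
    using ax4 assms finite_subset unfolding axiom4_def by blast
qed

section \<open>The modified distance and its monotonicity\<close>

definition HP :: "'i \<Rightarrow> 'i \<Rightarrow> 'i \<Rightarrow> 'i \<Rightarrow> bool" where
  "HP X Z X' Z' \<longleftrightarrow> X' \<in> Y \<and> Z' \<in> Y \<and> X' \<noteq> Z' \<and>
     ((X' \<notin> {X, Z} \<and> Z' \<notin> {X, Z} \<and> 2 * \<xi> < D X X' Z' \<and> 2 * \<xi> < D Z X' Z')
      \<or> (X' = X \<and> Z' \<noteq> Z \<and> 2 * \<xi> < D Z X Z')
      \<or> (Z' = Z \<and> X' \<noteq> X \<and> 2 * \<xi> < D X X' Z)
      \<or> (X' = X \<and> Z' = Z))"

lemma H_pairs_iff:
  assumes "X \<in> Y" "Z \<in> Y" "X \<noteq> Z"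
  shows "(X', Z') \<in> H_pairs Y C p \<xi> X Z \<longleftrightarrow> HP X Z X' Z'"
proof -
  have "(ereal (2 * \<xi>) < proj_dist C p V A B) = (2 * \<xi> < D V A B)"
    if "V \<in> Y" "A \<in> Y" "B \<in> Y" "V \<noteq> A" "V \<noteq> B" for V A B
    using proj_dist_eq[OF that] by simp
  then show ?thesis
    unfolding H_pairs_def HP_def mem_Collect_eq case_prod_conv using assms by (smt (verit) insertCI)
qed

lemma HP_cases [consumes 2]:
  assumes "r = \<xi>" "HP X Z X' Z'"
  obtains (far) "X' \<notin> {X, Z}" "Z' \<notin> {X, Z}" "2 * r < D X X' Z'" "2 * r < D Z X' Z'"
    | (left) "X' = X" "Z' \<noteq> Z" "X' \<noteq> Z'" "2 * r < D Z X Z'"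
    | (right) "Z' = Z" "X' \<noteq> X" "X' \<noteq> Z'" "2 * r < D X X' Z"
    | (eq) "X' = X" "Z' = Z"
  using assms(2) unfolding HP_def assms(1) by metis

lemma HP_swap: "HP X Z X' Z' \<longleftrightarrow> HP Z X Z' X'"
  unfolding HP_def using D_sym by (smt (verit) insert_commute)

lemma dmod_eq:
  assumes "X \<in> Y" "Z \<in> Y" "X \<noteq> Z" "V \<in> Y"
  shows "dmod V X Z = Inf {ereal (D V X' Z') | X' Z'. HP X Z X' Z' \<and> X' \<noteq> V \<and> Z' \<noteq> V}"
proof -
  have "(\<lambda>(X', Z'). proj_dist C p V X' Z') ` {(X', Z') \<in> H_pairs Y C p \<xi> X Z. X' \<noteq> V \<and> Z' \<noteq> V}
      = {ereal (D V X' Z') | X' Z'. HP X Z X' Z' \<and> X' \<noteq> V \<and> Z' \<noteq> V}" (is "?f ` ?A = ?B")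
  proof (intro equalityI subsetI)
    fix x assume "x \<in> ?f ` ?A"
    then obtain X' Z' where xz: "HP X Z X' Z'" "X' \<noteq> V" "Z' \<noteq> V" "x = proj_dist C p V X' Z'"
      using H_pairs_iff[OF assms(1-3)] by auto
    then show "x \<in> ?B" using proj_dist_eq[of V X' Z'] assms unfolding HP_def by blast
  next
    fix x assume "x \<in> ?B"
    then obtain X' Z' where xz: "HP X Z X' Z'" "X' \<noteq> V" "Z' \<noteq> V" "x = ereal (D V X' Z')"
      by auto
    then have "x = ?f (X', Z')" "(X', Z') \<in> ?A"
      using proj_dist_eq[of V X' Z'] assms H_pairs_iff[OF assms(1-3)] unfolding HP_def by auto
    then show "x \<in> ?f ` ?A" by blast
  qed
  then show ?thesis unfolding dmod_def mod_dist_def by simp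
qed

lemma dmod_sym:
  assumes "X \<in> Y" "Z \<in> Y" "X \<noteq> Z" "V \<in> Y"
  shows "dmod V X Z = dmod V Z X"
proof -
  have "{ereal (D V X' Z') | X' Z'. HP X Z X' Z' \<and> X' \<noteq> V \<and> Z' \<noteq> V}
      = {ereal (D V X' Z') | X' Z'. HP Z X X' Z' \<and> X' \<noteq> V \<and> Z' \<noteq> V}"
    using HP_swap D_sym by blast
  then show ?thesis
    unfolding dmod_eq[OF assms] dmod_eq[OF assms(2,1) assms(3)[symmetric] assms(4)] by simp
qed

lemma dmod_le_D:
  assumes "X \<in> Y" "Z \<in> Y" "X \<noteq> Z" "V \<in> Y" "V \<noteq> X" "V \<noteq> Z"
  shows "dmod V X Z \<le> ereal (D V X Z)"
proof -
  have "HP X Z X Z" using assms by (simp add: HP_def)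
  then show ?thesis unfolding dmod_eq[OF assms(1-4)] using assms by (intro Inf_lower) blast
qed

text \<open>\<open>X\<close> cannot see \<open>V\<close> within \<open>r\<close> of both
  \<open>X'\<close> and \<open>Z'\<close>, since these are more than 2 * r apart there. The one it
  sees far from \<open>V\<close> is seen by \<open>V\<close> close to \<open>X\<close>.\<close>

lemma far_witness_near:
  assumes "X \<in> Y" "V \<in> Y" "X' \<in> Y" "Z' \<in> Y" "X \<noteq> V" "X' \<noteq> X" "Z' \<noteq> X" "X' \<noteq> V" "Z' \<noteq> V"
    and "2 * r < D X X' Z'"
  shows "D V X X' \<le> r \<or> D V X Z' \<le> r"
proof -
  have "r < D X X' V \<or> r < D X V Z'"
    using D_triangle[of X X' V Z'] assms by fastforce
  then show ?thesis
    using behrstock[of X X' V] behrstock[of X V Z'] assms by auto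
qed

text \<open>On \<open>V\<close> each of \<open>X\<close> and \<open>Z\<close> is near one of
  \<open>X'\<close> and \<open>Z'\<close>. If these are different, the triangle inequality costs
  \<open>r\<close> at each end; if they are the same, \<open>D V X Z\<close> is at most 2 * r
  outright.\<close>

lemma HP_D_le:
  assumes "X \<in> Y" "Z \<in> Y" "X \<noteq> Z" "V \<in> Y" "V \<noteq> X" "V \<noteq> Z" "HP X Z X' Z'" "X' \<noteq> V" "Z' \<noteq> V"
  shows "D V X Z \<le> D V X' Z' + 2 * r"
proof -
  have xi: "r = \<xi>" using three_distinct[of X V Z] assms by blast
  have Y: "X' \<in> Y" "Z' \<in> Y" using assms(7) by (auto simp: HP_def)
  show ?thesis using xi assms(7)
  proof (cases rule: HP_cases)
    case far
    have "D V X X' \<le> r \<or> D V X Z' \<le> r"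
      using far_witness_near[of X V X' Z'] far assms Y by auto
    moreover have "D V Z X' \<le> r \<or> D V Z Z' \<le> r"
      using far_witness_near[of Z V X' Z'] far assms Y by auto
    moreover have "D V X Z \<le> D V X X' + D V X' Z" "D V X Z \<le> D V X Z' + D V Z' Z"
      "D V X' Z \<le> D V X' Z' + D V Z' Z" "D V Z' Z \<le> D V Z' X' + D V X' Z"
      using D_triangle assms Y by auto
    ultimately show ?thesis
      using D_sym[of V Z X'] D_sym[of V Z Z'] D_sym[of V X' Z'] D_nonneg[of V X' Z'] by linarith
  next
    case left
    have "D V Z X \<le> r \<or> D V Z Z' \<le> r"
      using far_witness_near[of Z V X Z'] left assms Y by auto
    then show ?thesis
      using D_triangle[of V X Z' Z] left assms Y D_sym[of V Z X] D_sym[of V Z Z'] D_nonneg[of V X' Z']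
        r_nonneg by force
  next
    case right
    have "D V X X' \<le> r \<or> D V X Z \<le> r"
      using far_witness_near[of X V X' Z] right assms Y by auto
    then show ?thesis
      using D_triangle[of V X X' Z] right assms Y D_nonneg[of V X' Z'] r_nonneg by force
  next
    case eq
    then show ?thesis using r_nonneg by simp
  qed
qed

lemma D_le_dmod:
  assumes "X \<in> Y" "Z \<in> Y" "X \<noteq> Z" "V \<in> Y" "V \<noteq> X" "V \<noteq> Z"
  shows "ereal (D V X Z - 2 * r) \<le> dmod V X Z"
  unfolding dmod_eq[OF assms(1-4)]
proof (rule Inf_greatest)
  fix x assume "x \<in> {ereal (D V X' Z') | X' Z'. HP X Z X' Z' \<and> X' \<noteq> V \<and> Z' \<noteq> V}"
  then show "ereal (D V X Z - 2 * r) \<le> x"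
    using HP_D_le[OF assms] by fastforce
qed

text \<open>Since \<open>W\<close> lies between \<open>X\<close> and \<open>Z\<close>, a pair that
  is far apart on \<open>Z\<close> is also far apart on \<open>W\<close>; in the case
  \<open>far\<close> the bound 4 * r leaves 2 * r after the error of \<open>HP_D_le\<close>. The
  pair may have to be swapped because \<open>W\<close> can be \<open>X'\<close>, while pairs for
  \<open>X\<close> and \<open>W\<close> admit \<open>W\<close> only as second entry.\<close>

lemma HP_mono:
  assumes "X \<in> Y" "Z \<in> Y" "X \<noteq> Z" "W \<in> Y" "W \<noteq> X" "W \<noteq> Z" "4 * r < D W X Z" "HP X Z X' Z'"
  shows "HP X W X' Z' \<or> HP X W Z' X'"
proof -
  have xi: "r = \<xi>" using three_distinct[of X W Z] assms by blast
  have Y: "X' \<in> Y" "Z' \<in> Y" "X' \<noteq> Z'" using assms(8) by (auto simp: HP_def)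
  have small: "D Z X W \<le> r" "D X W Z \<le> r"
    using behrstock[of W X Z] assms r_nonneg by auto
  show ?thesis using xi assms(8)
  proof (cases rule: HP_cases)
    case far
    consider "Z' = W" | "X' = W" | "X' \<noteq> W" "Z' \<noteq> W" by auto
    then show ?thesis
    proof cases
      case 3
      have "2 * r < D W X' Z'"
        using HP_D_le[OF assms(1-6,8) 3] assms(7) by linarith
      then show ?thesis using far Y 3 xi by (auto simp: HP_def)
    qed (use far Y xi D_sym[of X X' Z'] in \<open>auto simp: HP_def\<close>)
  next
    case left
    show ?thesis
    proof (cases "Z' = W")
      case True
      then show ?thesis using left Y by (auto simp: HP_def)
    next
      case False
      have "r < D Z W Z'"
        using D_triangle[of Z X W Z'] left small assms Y by auto
      then have "D W Z Z' \<le> r" using behrstock[of Z W Z'] left assms Y False by auto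
      then have "2 * r < D W X Z'"
        using D_triangle[of W X Z' Z] left assms Y False D_sym[of W Z Z'] r_nonneg by auto
      then show ?thesis using left Y xi False by (auto simp: HP_def)
    qed
  next
    case right
    have W: "X' \<noteq> W" using right small r_nonneg by auto
    have "r < D X X' W"
      using D_triangle[of X X' W Z] right small assms Y by auto
    then have "D W X' X \<le> r" using behrstock[of X X' W] right assms Y W by auto
    then have "2 * r < D W X' Z"
      using D_triangle[of W X X' Z] right assms Y W D_sym[of W X X'] r_nonneg by auto
    then show ?thesis using right Y xi W assms by (auto simp: HP_def)
  next
    case eq
    then show ?thesis using assms xi r_nonneg by (auto simp: HP_def)
  qed
qed

text \<open>An infimum over more pairs, hence no error term. For \<open>D\<close> the same
  comparison carries an error; exactness is what the modification is for.\<close>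

lemma dmod_mono_left:
  assumes "X \<in> Y" "Z \<in> Y" "X \<noteq> Z" "W \<in> Y" "W \<noteq> X" "W \<noteq> Z" "4 * r < D W X Z" "V \<in> Y"
  shows "dmod V X W \<le> dmod V X Z"
proof -
  have "{ereal (D V X' Z') | X' Z'. HP X Z X' Z' \<and> X' \<noteq> V \<and> Z' \<noteq> V}
      \<subseteq> {ereal (D V X' Z') | X' Z'. HP X W X' Z' \<and> X' \<noteq> V \<and> Z' \<noteq> V}"
    using HP_mono[OF assms(1-7)] D_sym by blast
  then show ?thesis
    unfolding dmod_eq[OF assms(1-3,8)] dmod_eq[OF assms(1,4) assms(5)[symmetric] assms(8)]
    by (rule Inf_superset_mono)
qed

lemma dmod_mono_right:
  assumes "X \<in> Y" "Z \<in> Y" "X \<noteq> Z" "W \<in> Y" "W \<noteq> X" "W \<noteq> Z" "4 * r < D W X Z" "V \<in> Y"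
  shows "dmod V W Z \<le> dmod V X Z"
  using dmod_mono_left[of Z X W V] assms dmod_sym[of X Z V] dmod_sym[of W Z V] D_sym[of W X Z]
  by metis

section \<open>Adjacency of indices and connectedness\<close>

lemma E_iff: "E X Z \<longleftrightarrow> X \<in> Y \<and> Z \<in> Y \<and> X \<noteq> Z \<and> (\<forall>V \<in> Y - {X, Z}. dmod V X Z \<le> ereal K)"
  unfolding PK_edge_def dmod_def ..

lemma E_sym: "E X Z \<Longrightarrow> E Z X"
  unfolding E_iff using dmod_sym[of X Z] by auto

lemma E_D_le:
  assumes "E X Z" "V \<in> Y" "V \<noteq> X" "V \<noteq> Z"
  shows "D V X Z \<le> K + 2 * r"
proof -
  have "ereal (D V X Z - 2 * r) \<le> ereal K"
    using D_le_dmod[of X Z V] assms unfolding E_iff by (meson DiffI empty_iff insertE order_trans)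
  then show ?thesis by simp
qed

text \<open>Monotonicity of \<open>dmod\<close> transfers the bounds to every third index other than
  the replaced end. About that end the adjacency of \<open>X\<close> and \<open>Z\<close> says
  nothing, but it sees the other two within \<open>r\<close> by \<open>behrstock\<close>.\<close>

lemma E_between:
  assumes "E X Z" "W \<in> Y" "W \<noteq> X" "W \<noteq> Z" "4 * r < D W X Z"
  shows "E X W" "E W Z"
proof -
  have X: "X \<in> Y" "Z \<in> Y" "X \<noteq> Z" using assms(1) by (auto simp: E_iff)
  have le: "dmod V X Z \<le> ereal K" if "V \<in> Y" "V \<noteq> X" "V \<noteq> Z" for V
    using assms(1) that by (auto simp: E_iff)
  have small: "D Z X W \<le> K" "D X W Z \<le> K"
    using behrstock[of W X Z] assms X r_nonneg K_ge by auto
  show "E X W" unfolding E_iff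
  proof (intro conjI ballI)
    fix V assume V: "V \<in> Y - {X, W}"
    show "dmod V X W \<le> ereal K"
    proof (cases "V = Z")
      case True
      then show ?thesis using dmod_le_D[of X W Z] X assms small by (simp add: order_trans)
    next
      case False
      then show ?thesis using dmod_mono_left[of X Z W V] X assms le[of V] V by auto
    qed
  qed (use X assms in auto)
  show "E W Z" unfolding E_iff
  proof (intro conjI ballI)
    fix V assume V: "V \<in> Y - {W, Z}"
    show "dmod V W Z \<le> ereal K"
    proof (cases "V = X")
      case True
      then show ?thesis using dmod_le_D[of W Z X] X assms small by (simp add: order_trans)
    next
      case False
      then show ?thesis using dmod_mono_right[of X Z W V] X assms le[of V] V by auto
    qed
  qed (use X assms in auto)
qed

text \<open>The indices between \<open>X\<close> and \<open>Z\<close>, measured by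
  \<open>dmod\<close> so that the sets are exactly nested. Two levels occur: \<open>K\<close>, where
  emptiness means adjacency, and 4 * r, where centres are searched.\<close>

definition T :: "real \<Rightarrow> 'i \<Rightarrow> 'i \<Rightarrow> 'i set" where
  "T \<kappa> X Z = {V \<in> Y - {X, Z}. ereal \<kappa> < dmod V X Z}"

lemma T_D_gt:
  assumes "X \<in> Y" "Z \<in> Y" "X \<noteq> Z" "V \<in> T \<kappa> X Z"
  shows "\<kappa> < D V X Z"
proof -
  have "ereal \<kappa> < ereal (D V X Z)"
    using assms by (intro less_le_trans[OF _ dmod_le_D[of X Z V]]) (auto simp: T_def)
  then show ?thesis by simp
qed

lemma finite_T:
  assumes "X \<in> Y" "Z \<in> Y" "X \<noteq> Z" "r \<le> \<kappa>"
  shows "finite (T \<kappa> X Z)"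
proof (rule finite_subset[OF _ finite_D_ge[OF assms(1,2)]])
  show "T \<kappa> X Z \<subseteq> {V \<in> Y - {X, Z}. r \<le> D V X Z}"
    using T_D_gt[OF assms(1-3)] assms(4) by (force simp: T_def)
qed

text \<open>Strictness comes from \<open>V\<close>, which is lost. The replaced end is not gained,
  as it sees the other two within \<open>r\<close>.\<close>

lemma T_subset:
  assumes "X \<in> Y" "Z \<in> Y" "X \<noteq> Z" "4 * r \<le> \<kappa>" "V \<in> T \<kappa> X Z"
  shows "T \<kappa> X V \<subset> T \<kappa> X Z" "T \<kappa> V Z \<subset> T \<kappa> X Z"
proof -
  have V: "V \<in> Y" "V \<noteq> X" "V \<noteq> Z" "\<kappa> < D V X Z"
    using assms T_D_gt[OF assms(1-3,5)] by (auto simp: T_def)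
  then have small: "D Z X V \<le> r" "D X V Z \<le> r"
    using behrstock[of V X Z] assms r_nonneg by auto
  have "Z \<notin> T \<kappa> X V" "X \<notin> T \<kappa> V Z"
    using T_D_gt[of X V Z \<kappa>] T_D_gt[of V Z X \<kappa>] V small assms r_nonneg by fastforce+
  moreover have "dmod U X V \<le> dmod U X Z" "dmod U V Z \<le> dmod U X Z" if "U \<in> Y" for U
    using dmod_mono_left[of X Z V U] dmod_mono_right[of X Z V U] V assms that by auto
  ultimately have "T \<kappa> X V \<subseteq> T \<kappa> X Z" "T \<kappa> V Z \<subseteq> T \<kappa> X Z"
    unfolding T_def by (auto intro: less_le_trans)
  moreover have "V \<notin> T \<kappa> X V" "V \<notin> T \<kappa> V Z" by (auto simp: T_def)
  ultimately show "T \<kappa> X V \<subset> T \<kappa> X Z" "T \<kappa> V Z \<subset> T \<kappa> X Z"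
    using assms(5) by auto
qed

lemma T_empty_iff:
  assumes "X \<in> Y" "Z \<in> Y" "X \<noteq> Z"
  shows "T K X Z = {} \<longleftrightarrow> E X Z"
  using assms by (auto simp: T_def E_iff not_less)

lemma PK_connected:
  assumes "X \<in> Y" "Z \<in> Y"
  shows "E\<^sup>*\<^sup>* X Z"
  using assms
proof (induction "card (T K X Z)" arbitrary: X Z rule: less_induct)
  case less
  show ?case
  proof (cases "X = Z \<or> E X Z")
    case True
    then show ?thesis by auto
  next
    case False
    then obtain V where V: "V \<in> T K X Z" using T_empty_iff less by blast
    have "finite (T K X Z)" using finite_T[of X Z K] less False K_ge r_nonneg by auto
    then have "card (T K X V) < card (T K X Z)" "card (T K V Z) < card (T K X Z)"
      using T_subset[of X Z K V] less False V K_ge r_nonneg by (auto intro!: psubset_card_mono)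
    then have "E\<^sup>*\<^sup>* X V" "E\<^sup>*\<^sup>* V Z" using less V by (auto simp: T_def)
    then show ?thesis by (rule rtranclp_trans)
  qed
qed

text \<open>\<open>V\<close> is taken in \<open>T K X W\<close> with as few indices between it and
  \<open>W\<close> as possible. An index between \<open>V\<close> and \<open>W\<close> would belong
  to \<open>T K X W\<close> as well and have fewer, so there is none.\<close>

lemma adjacent_separator:
  assumes "X \<in> Y" "W \<in> Y" "X \<noteq> W" "\<not> E X W"
  shows "\<exists>V. V \<noteq> X \<and> E V W \<and> K < D V X W"
  using assms
proof -
  have ne: "T K X W \<noteq> {}" using T_empty_iff assms by auto
  obtain V where V: "V \<in> T K X W" and min: "\<And>U. U \<in> T K X W \<Longrightarrow> card (T K V W) \<le> card (T K U W)"
    using ex_has_least_nat[of "\<lambda>V. V \<in> T K X W" _ "\<lambda>V. card (T K V W)"] ne by blast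
  have V': "V \<in> Y" "V \<noteq> X" "V \<noteq> W" using V by (auto simp: T_def)
  have "E V W"
  proof (rule ccontr)
    assume "\<not> E V W"
    then obtain U where U: "U \<in> T K V W" using T_empty_iff[of V W] V' assms by auto
    have "T K U W \<subset> T K V W" using T_subset(2)[of V W K U] U V' assms K_ge r_nonneg by auto
    moreover have "U \<in> T K X W" using T_subset(2)[of X W K V] U V assms K_ge r_nonneg by auto
    moreover have "finite (T K V W)" using finite_T[of V W K] V' assms K_ge r_nonneg by auto
    ultimately show False using min[of U] psubset_card_mono[of "T K V W" "T K U W"] by simp
  qed
  then show ?thesis using T_D_gt[of X W V K] V V' assms by auto
qed

section \<open>Barriers\<close>

definition bars :: "'i \<Rightarrow> real \<Rightarrow> 'i \<Rightarrow> 'i \<Rightarrow> bool" where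
  "bars W t V X \<longleftrightarrow> W \<in> Y \<and> V \<in> Y \<and> X \<in> Y \<and> V \<noteq> W \<and> X \<noteq> W \<and> (V = X \<or> t < D V X W)"

lemma bars_mono: "bars W t V X \<Longrightarrow> s \<le> t \<Longrightarrow> bars W s V X"
  unfolding bars_def by auto

text \<open>By Axiom (3) one of the two barriers sees \<open>X\<close> close to the other barrier,
  and so sees that barrier almost as far from \<open>W\<close> as it sees \<open>X\<close>.\<close>

lemma bars_compare:
  assumes "bars W s U X" "bars W t V X" "U \<noteq> V"
  shows "s - r < D U V W \<or> t - r < D V U W"
proof -
  have Y: "W \<in> Y" "U \<in> Y" "V \<in> Y" "X \<in> Y" "U \<noteq> W" "V \<noteq> W" "X \<noteq> W"
    using assms by (auto simp: bars_def)
  consider "X = U" | "X = V" | "X \<noteq> U" "X \<noteq> V" by auto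
  then show ?thesis
  proof cases
    case 3
    have far: "s < D U X W" "t < D V X W" using assms 3 by (auto simp: bars_def)
    have "D U X V \<le> r \<or> D V X U \<le> r"
      using behrstock(1)[of U X V] Y 3 assms(3) by force
    then show ?thesis
    proof
      assume "D U X V \<le> r"
      then show ?thesis using far D_triangle[of U X V W] Y 3 assms(3) by auto
    next
      assume "D V X U \<le> r"
      then show ?thesis using far D_triangle[of V X U W] Y 3 assms(3) by auto
    qed
  qed (use assms r_nonneg in \<open>auto simp: bars_def\<close>)
qed

text \<open>From \<open>U\<close>, \<open>V\<close> looks close to \<open>W\<close> and therefore
  not close to \<open>X\<close>, so \<open>V\<close> sees \<open>X\<close> within \<open>r\<close>
  of \<open>U\<close>. The strength \<open>s\<close> only has to exceed these errors; the new
  strength depends on \<open>t\<close> alone.\<close>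

lemma bars_trans:
  assumes "bars W s U X" "V \<in> Y" "V \<noteq> U" "V \<noteq> W" "t < D V U W" "2 * r \<le> s" "r \<le> t"
  shows "bars W (t - r) V X"
proof -
  have Y: "W \<in> Y" "U \<in> Y" "X \<in> Y" "U \<noteq> W" "X \<noteq> W"
    using assms by (auto simp: bars_def)
  consider "X = U" | "X = V" | "X \<noteq> U" "X \<noteq> V" by auto
  then show ?thesis
  proof cases
    case 3
    have "s < D U X W" using assms 3 by (auto simp: bars_def)
    moreover have "D U V W \<le> r" using behrstock[of V U W] Y assms by auto
    ultimately have "r < D U X V"
      using D_triangle[of U X V W] Y assms 3 by auto
    then have "D V X U \<le> r" using behrstock[of U X V] Y assms 3 by auto
    then have "t - r < D V X W"
      using D_triangle[of V U X W] D_sym[of V U X] Y assms 3 by auto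
    then show ?thesis using Y assms by (auto simp: bars_def)
  qed (use assms r_nonneg Y in \<open>auto simp: bars_def\<close>)
qed

text \<open>A barrier that dominates the barriers of later steps is not crossed, and this is where the
  errors do not accumulate: the induction hypothesis bounds the drift seen from it at once.\<close>

lemma common_barrier:
  assumes "4 * r \<le> \<theta>" "0 < n"
    and "\<And>i. i < n \<Longrightarrow> bars W \<theta> (V i) (X i) \<and> bars W \<theta> (V i) (X (Suc i))"
  shows "\<exists>j<n. \<forall>i\<le>n. bars W (\<theta> - 2 * r) (V j) (X i)"
  using assms(2,3)
proof (induction n arbitrary: X V rule: less_induct)
  case (less n)
  obtain k where k: "n = Suc k" using less.prems(1) by (cases n) auto
  have step: "bars W \<theta> (V i) (X i)" "bars W \<theta> (V i) (X (Suc i))" if "i \<le> k" for i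
    using less.prems(2)[of i] that k by auto
  have weaken: "bars W (\<theta> - 2 * r) A B" if "bars W \<theta> A B" for A B
    using bars_mono[OF that] r_nonneg by simp
  show ?case
  proof (cases "k = 0")
    case True
    then show ?thesis using step[of 0] weaken k by (auto simp: le_Suc_eq)
  next
    case False
    \<comment> \<open>Of the barriers that serve all terms up to \<open>k\<close>, the last one is
      taken. Every later \<open>V i\<close> with \<open>i < k\<close> then fails for some
      term.\<close>
    define J where "J = {j. j < k \<and> (\<forall>i\<le>k. bars W (\<theta> - 2 * r) (V j) (X i))}"
    have "\<exists>j<k. \<forall>i\<le>k. bars W (\<theta> - 2 * r) (V j) (X i)"
      using less.IH[of k V X] step False k by auto
    then have J: "finite J" "J \<noteq> {}" by (auto simp: J_def)
    define j where "j = Max J"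
    have "j \<in> J" using J j_def by auto
    then have j: "j < k" "\<And>i. i \<le> k \<Longrightarrow> bars W (\<theta> - 2 * r) (V j) (X i)"
      by (auto simp: J_def)
    have jmax: "i \<notin> J" if "j < i" for i
      using Max_ge[OF J(1), of i] that by (auto simp: j_def)
    have Y: "W \<in> Y" "V i \<in> Y" "V i \<noteq> W" if "i \<le> k" for i
      using step[OF that] by (auto simp: bars_def)
    \<comment> \<open>Here \<open>bars_trans\<close> loses \<open>r\<close> from \<theta> - r,
      whatever the barrier \<open>V j\<close> has lost before; it needs \<theta> - 2 * r \<ge> 2 *
      r, which is the hypothesis on \<theta>.\<close>
    have later: "\<forall>l\<le>k. bars W (\<theta> - 2 * r) (V i) (X l)"
      if "i \<le> k" "V i \<noteq> V j" "\<theta> - r < D (V i) (V j) W" for i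
    proof (intro allI impI)
      fix l assume "l \<le> k"
      then have "bars W ((\<theta> - r) - r) (V i) (X l)"
        using that Y[of i] assms(1) r_nonneg j(2)[of l]
        by (intro bars_trans[where U = "V j" and s = "\<theta> - 2 * r"]) auto
      then show "bars W (\<theta> - 2 * r) (V i) (X l)" by (rule bars_mono) simp
    qed
    show ?thesis
    proof (cases "V k = V j \<or> \<theta> - r < D (V k) (V j) W")
      case True
      then have "\<forall>l\<le>k. bars W (\<theta> - 2 * r) (V k) (X l)"
        using later[of k] j(2) by fastforce
      then show ?thesis using step(2)[of k] weaken k by (auto simp: le_Suc_eq)
    next
      case far: False
      define U where "U = V j"
      \<comment> \<open>Maximality of \<open>j\<close> for \<open>i < k\<close>, and the case
        assumption for \<open>i = k\<close>, forbid that \<open>V i\<close> lies between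
        \<open>V j\<close> and \<open>W\<close>. By \<open>bars_compare\<close>, \<open>V j\<close>
        then lies between \<open>V i\<close> and \<open>W\<close>.\<close>
      have dominated: "V i \<noteq> U" "\<theta> - 3 * r < D U (V i) W" if "j < i" "i \<le> k" for i
      proof -
        have "\<not> (\<forall>l\<le>k. bars W (\<theta> - 2 * r) (V i) (X l))" if "i < k"
          using jmax[OF \<open>j < i\<close>] that by (auto simp: J_def)
        then show ne: "V i \<noteq> U"
          using far j(2) that unfolding U_def by (metis le_neq_implies_less)
        have "\<not> \<theta> - r < D (V i) (V j) W"
          using \<open>i < k \<Longrightarrow> _\<close> later[of i] far that ne unfolding U_def by (metis le_neq_implies_less)
        then show "\<theta> - 3 * r < D U (V i) W"
          using bars_compare[OF j(2)[of i] step(1)[of i]] that ne unfolding U_def by auto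
      qed
      have "\<exists>i<k - j. \<forall>l\<le>k - j. bars W (\<theta> - 2 * r) (V (Suc j + i)) (X (Suc j + l))"
        using j(1) k step by (intro less.IH) auto
      then obtain i where i: "i < k - j"
        "\<And>l. l \<le> k - j \<Longrightarrow> bars W (\<theta> - 2 * r) (V (Suc j + i)) (X (Suc j + l))"
        by blast
      define B where "B = V (Suc j + i)"
      have B: "bars W (\<theta> - 2 * r) B (X (Suc j))" "bars W (\<theta> - 2 * r) B (X (Suc k))"
        using i(2)[of 0] i(2)[of "k - j"] j(1) by (auto simp: B_def)
      have BU: "B \<noteq> U" "\<theta> - 3 * r < D U B W"
        using dominated[of "Suc j + i"] i(1) by (auto simp: B_def)
      have UY: "W \<in> Y" "U \<in> Y" "U \<noteq> W" "B \<in> Y" "B \<noteq> W"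
        using Y[of j] j(1) B by (auto simp: U_def bars_def)
      have "D B U W \<le> r"
        using behrstock[of U B W] behrstock[of B U W] BU UY assms(1) r_nonneg D_sym by force
      \<comment> \<open>The steps after \<open>j\<close> are replaced by their common barrier
        \<open>B\<close>. As \<open>B\<close> sees \<open>U\<close> close to \<open>W\<close>,
        whatever \<open>B\<close> bars is seen by \<open>U\<close> close to
        \<open>B\<close>.\<close>
      have near: "Z = B \<or> D U Z B \<le> r" if "bars W (\<theta> - 2 * r) B Z" "Z \<noteq> U" for Z
      proof (rule ccontr)
        assume *: "\<not> (Z = B \<or> D U Z B \<le> r)"
        then have Z: "Z \<noteq> B" "Z \<in> Y" "Z \<noteq> W" "\<theta> - 2 * r < D B Z W"
          using that by (auto simp: bars_def)
        have "r < D B Z U"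
          using D_triangle[of B Z U W] Z UY BU \<open>D B U W \<le> r\<close> assms(1) r_nonneg by auto
        then have "D U Z B \<le> r" using behrstock[of B Z U] Z UY BU that by auto
        then show False using * by simp
      qed
      have "bars W \<theta> U (X (Suc j))" using step(2)[of j] j(1) by (simp add: U_def)
      moreover have "X (Suc j) \<noteq> U"
        using B(1) BU \<open>D B U W \<le> r\<close> assms(1) r_nonneg by (auto simp: bars_def)
      ultimately have first: "\<theta> < D U (X (Suc j)) W" "X (Suc j) \<in> Y" by (auto simp: bars_def)
      \<comment> \<open>\<open>U\<close> bars \<open>X (Suc j)\<close> with full strength \<theta>.
        One \<open>r\<close> is lost from there to \<open>B\<close> and one from \<open>B\<close> to
        \<open>X (Suc k)\<close>, so the tail costs 2 * r, however long it is.\<close>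
      have "\<theta> - r < D U B W"
        using near[OF B(1) \<open>X (Suc j) \<noteq> U\<close>] first D_triangle[of U "X (Suc j)" B W] UY BU
          \<open>X (Suc j) \<noteq> U\<close> r_nonneg by auto
      then have "bars W (\<theta> - 2 * r) U (X (Suc k))" if "X (Suc k) \<noteq> U"
        using that near[OF B(2)] D_triangle[of U B "X (Suc k)" W] D_sym[of U B "X (Suc k)"] UY BU B(2)
          r_nonneg by (auto simp: bars_def)
      then have "bars W (\<theta> - 2 * r) U (X (Suc k))"
        using B(2) UY by (cases "X (Suc k) = U") (auto simp: bars_def)
      then have "\<forall>i\<le>n. bars W (\<theta> - 2 * r) (V j) (X i)"
        using j(2) k by (auto simp: U_def le_Suc_eq)
      then show ?thesis using j(1) k less_SucI by blast
    qed
  qed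
qed

text \<open>Strength 8 * r leaves 6 * r after \<open>common_barrier\<close>. Paths are described by
  the closure of this relation, so the number of their steps does not matter.\<close>

definition link :: "'i \<Rightarrow> 'i \<Rightarrow> 'i \<Rightarrow> bool" where
  "link W X Z \<longleftrightarrow> (\<exists>V. bars W (8 * r) V X \<and> bars W (8 * r) V Z)"

lemma link_refl: "W \<in> Y \<Longrightarrow> X \<in> Y \<Longrightarrow> X \<noteq> W \<Longrightarrow> link W X X"
  unfolding link_def bars_def by auto

lemma link_sym: "link W X Z \<Longrightarrow> link W Z X"
  unfolding link_def by auto

lemma rtranclp_link_sym: "(link W)\<^sup>*\<^sup>* X Z \<Longrightarrow> (link W)\<^sup>*\<^sup>* Z X"
  by (induction rule: rtranclp_induct) (auto intro: converse_rtranclp_into_rtranclp dest: link_sym)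

lemma rtranclp_link_barrier:
  assumes "(link W)\<^sup>*\<^sup>* X Z" "W \<in> Y" "X \<in> Y" "X \<noteq> W"
  shows "\<exists>U. bars W (6 * r) U X \<and> bars W (6 * r) U Z"
proof -
  obtain n f where f: "f 0 = X" "f n = Z" "\<And>i. i < n \<Longrightarrow> link W (f i) (f (Suc i))"
    using assms(1) by (auto dest!: rtranclp_imp_relpowp simp: relpowp_fun_conv)
  show ?thesis
  proof (cases "n = 0")
    case True
    then show ?thesis using f assms by (auto simp: bars_def)
  next
    case False
    obtain V where V: "\<And>i. i < n \<Longrightarrow> bars W (8 * r) (V i) (f i) \<and> bars W (8 * r) (V i) (f (Suc i))"
      using f(3) unfolding link_def by metis
    obtain j where "\<forall>i\<le>n. bars W (8 * r - 2 * r) (V j) (f i)"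
      using common_barrier[of "8 * r" n W V f] V False r_nonneg by auto
    then have "\<And>i. i \<le> n \<Longrightarrow> bars W (6 * r) (V j) (f i)" by simp
    from this[of 0] this[of n] show ?thesis using f(1,2) by auto
  qed
qed

lemma barrier_D_le:
  assumes "bars W t U X" "bars W t U Z" "X \<noteq> Z" "r \<le> t"
  shows "D W X Z \<le> 2 * r"
proof -
  have Y: "W \<in> Y" "U \<in> Y" "X \<in> Y" "Z \<in> Y" "U \<noteq> W" "X \<noteq> W" "Z \<noteq> W"
    using assms by (auto simp: bars_def)
  have near: "A = U \<or> D W A U \<le> r" if "bars W t U A" for A
  proof (cases "A = U")
    case False
    then show ?thesis using behrstock(1)[of U A W] that assms(4) by (simp add: bars_def)
  qed simp
  show ?thesis
    using near[OF assms(1)] near[OF assms(2)] D_triangle[of W X U Z] D_sym[of W U Z] Y assms(3)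
      r_nonneg by auto
qed

section \<open>Centres of triples of indices\<close>

definition sep :: "'i \<Rightarrow> 'i \<Rightarrow> 'i \<Rightarrow> bool" where
  "sep W A B \<longleftrightarrow> W = A \<or> W = B \<or> (A \<noteq> B \<and> 2 * r < D W A B)"

text \<open>The 2 * r in \<open>sep\<close> is the bound of \<open>barrier_D_le\<close>, and nothing
  bars \<open>W\<close> from itself.\<close>

lemma sep_no_barrier:
  assumes "sep W A B" "bars W (6 * r) U A" "bars W (6 * r) U B"
  shows False
  using assms barrier_D_le[of W "6 * r" U A B] r_nonneg by (auto simp: sep_def bars_def)

text \<open>\<open>W\<close> sees \<open>U\<close> close to \<open>B\<close>, hence away from
  \<open>A\<close>, so \<open>U\<close> sees \<open>A\<close> close to \<open>W\<close>; and
  \<open>U\<close> sees \<open>W\<close> far from \<open>B\<close>.\<close>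

lemma barrier_sep:
  assumes "sep W A B" "bars W (6 * r) U B" "A \<in> Y"
  shows "sep U A B"
proof -
  have Y: "W \<in> Y" "U \<in> Y" "B \<in> Y" "U \<noteq> W" "B \<noteq> W" "U \<noteq> B \<Longrightarrow> 6 * r < D U B W"
    using assms by (auto simp: bars_def)
  show ?thesis
  proof (cases "U = A \<or> U = B \<or> W = A")
    case True
    then show ?thesis using Y D_sym[of U A B] r_nonneg by (auto simp: sep_def)
  next
    case False
    then have *: "6 * r < D U B W" "A \<noteq> B" "2 * r < D W A B" using Y assms by (auto simp: sep_def)
    have "D W B U \<le> r" using behrstock[of U B W] * Y False r_nonneg by auto
    then have "r < D W A U" using D_triangle[of W A U B] D_sym[of W U B] * Y False assms by auto
    then have "D U A W \<le> r" using behrstock[of W A U] Y False assms by auto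
    then have "2 * r < D U A B"
      using D_triangle[of U B A W] D_sym[of U A B] * Y False assms r_nonneg by auto
    then show ?thesis using * by (simp add: sep_def)
  qed
qed

text \<open>If \<open>W\<close> cannot serve as the centre of a triple then a barrier moves it away from \<open>A\<close>, which
  shrinks the finite set \<open>T (4 * r) W B\<close>.\<close>

lemma ex_centre:
  assumes "A \<in> Y" "B \<in> Y" "Z \<in> Y"
  shows "\<exists>W\<in>Y. sep W A B \<and> sep W A Z \<and> \<not> (\<exists>U. bars W (6 * r) U B \<and> bars W (6 * r) U Z)"
proof -
  have "\<exists>W'\<in>Y. sep W' A B \<and> sep W' A Z \<and> \<not> (\<exists>U. bars W' (6 * r) U B \<and> bars W' (6 * r) U Z)"
    if "W \<in> Y" "sep W A B" "sep W A Z" for W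
    using that
  proof (induction "card (T (4 * r) W B)" arbitrary: W rule: less_induct)
    case less
    show ?case
    proof (cases "\<exists>U. bars W (6 * r) U B \<and> bars W (6 * r) U Z")
      case True
      then obtain U where U: "bars W (6 * r) U B" "bars W (6 * r) U Z" by blast
      then have Y: "U \<in> Y" "U \<noteq> W" "B \<noteq> W" by (auto simp: bars_def)
      have sep: "sep U A B" "sep U A Z" using barrier_sep U less.prems assms by auto
      show ?thesis
      proof (cases "U = B")
        case True
        then have "\<not> (\<exists>V. bars U (6 * r) V B \<and> bars U (6 * r) V Z)" by (auto simp: bars_def)
        then show ?thesis using sep Y by blast
      next
        case False
        then have "6 * r < D U B W" using U by (auto simp: bars_def)
        then have "ereal (4 * r) < ereal (D U W B - 2 * r)" using D_sym[of U W B] by simp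
        also have "\<dots> \<le> dmod U W B" using D_le_dmod[of W B U] Y less.prems assms False by auto
        finally have "U \<in> T (4 * r) W B" using Y False by (auto simp: T_def)
        then have "card (T (4 * r) U B) < card (T (4 * r) W B)"
          using T_subset(2)[of W B "4 * r" U] finite_T[of W B "4 * r"] less.prems assms Y r_nonneg
          by (intro psubset_card_mono) auto
        then show ?thesis using less.hyps sep Y by blast
      qed
    qed (use less in blast)
  qed
  from this[of A] show ?thesis using assms by (auto simp: sep_def)
qed

section \<open>The metric space\<close>

abbreviation pts :: "('i, 'a) point set" where "pts \<equiv> BBF_points Y C p \<xi> K"
abbreviation ch :: "('i, 'a) point \<Rightarrow> ('i, 'a) point \<Rightarrow> real \<Rightarrow> bool" where "ch \<equiv> chain Y C p \<xi> K"
abbreviation d :: "('i, 'a) point \<Rightarrow> ('i, 'a) point \<Rightarrow> real" where "d \<equiv> BBF_dist Y C p \<xi> K"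
abbreviation edge :: "'i \<times> 'a \<Rightarrow> 'i \<times> 'a \<Rightarrow> bool" where "edge \<equiv> BBF_edge Y C p \<xi> K"
abbreviation vpoint :: "'i \<times> 'a \<Rightarrow> ('i, 'a) point" where "vpoint u \<equiv> space_point (fst u) (snd u)"

definition verts :: "('i \<times> 'a) set" where "verts = Sigma Y (\<lambda>X. mspace (C X))"

definition supp :: "('i, 'a) point \<Rightarrow> ('i \<times> 'a) set" where "supp q = {w. q w \<noteq> 0}"

lemma edge_point_0 [simp]: "edge_point u v 0 = vpoint u"
  and edge_point_1 [simp]: "edge_point u v 1 = vpoint v"
  by (auto simp: edge_point_def space_point_def)

lemma edgeD:
  assumes "edge u v"
  shows "u \<in> verts" "v \<in> verts" "fst u \<noteq> fst v" "E (fst u) (fst v)" "edge v u"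
    "fst u \<in> Y" "fst v \<in> Y" "snd u \<in> p (fst u) (fst v)" "snd v \<in> p (fst v) (fst u)"
proof -
  show *: "E (fst u) (fst v)" "snd u \<in> p (fst u) (fst v)" "snd v \<in> p (fst v) (fst u)"
    using assms by (auto simp: BBF_edge_def)
  then show Y: "fst u \<noteq> fst v" "fst u \<in> Y" "fst v \<in> Y" by (auto simp: E_iff)
  show "u \<in> verts" "v \<in> verts"
    using * Y p_subset[of "fst u" "fst v"] p_subset[of "fst v" "fst u"]
    unfolding verts_def by (metis (no_types) SigmaI prod.collapse subsetD)+
  show "edge v u" using * E_sym by (auto simp: BBF_edge_def)
qed

lemma space_point_in_pts: "X \<in> Y \<Longrightarrow> a \<in> mspace (C X) \<Longrightarrow> space_point X a \<in> pts"
  unfolding BBF_points_def piece_def by blast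

lemma vpoint_in_pts: "u \<in> verts \<Longrightarrow> vpoint u \<in> pts"
  by (auto simp: verts_def intro: space_point_in_pts)

lemma edge_point_in_pts: "edge u v \<Longrightarrow> t \<in> {0..1} \<Longrightarrow> edge_point u v t \<in> pts"
  unfolding BBF_points_def by blast

lemma pts_cases:
  assumes "q \<in> pts"
  obtains (vertex) u where "u \<in> verts" "q = vpoint u"
    | (edge) u v t where "edge u v" "0 < t" "t < 1" "q = edge_point u v t"
proof -
  consider X a where "X \<in> Y" "a \<in> mspace (C X)" "q = space_point X a"
    | u v t where "edge u v" "t \<in> {0..1}" "q = edge_point u v t"
    using assms by (auto simp: BBF_points_def piece_def)
  then show ?thesis
  proof cases
    case 1
    then show ?thesis using vertex[of "(X, a)"] by (simp add: verts_def)
  next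
    case 2
    show ?thesis
    proof (cases "t = 0 \<or> t = 1")
      case True
      then show ?thesis using vertex[of u] vertex[of v] edgeD[OF 2(1)] 2 by auto
    next
      case False
      then show ?thesis using edge[of u v t] 2 by auto
    qed
  qed
qed

lemma supp_vpoint [simp]: "supp (vpoint u) = {u}"
  and supp_space_point [simp]: "supp (space_point X a) = {(X, a)}"
  by (auto simp: supp_def space_point_def indicator_def)

lemma supp_edge_point:
  assumes "u \<noteq> v"
  shows "supp (edge_point u v t) = (if t = 0 then {u} else if t = 1 then {v} else {u, v})"
  using assms by (auto simp: supp_def edge_point_def indicator_def)

lemma supp_edge_point_subset: "supp (edge_point u v t) \<subseteq> {u, v}"
  by (auto simp: supp_def edge_point_def indicator_def)

lemma supp_pts:
  assumes "q \<in> pts"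
  shows "finite (supp q)" "supp q \<noteq> {}" "supp q \<subseteq> verts"
  using assms
  by (cases rule: pts_cases; use edgeD in \<open>auto simp: supp_edge_point\<close>)+

lemma chain_pts: "ch x y L \<Longrightarrow> x \<in> pts \<and> y \<in> pts \<and> 0 \<le> L"
  by (induction rule: chain.induct) (auto simp: space_point_in_pts edge_point_in_pts)

lemma chain_space:
  "X \<in> Y \<Longrightarrow> a \<in> mspace (C X) \<Longrightarrow> b \<in> mspace (C X)
    \<Longrightarrow> ch (space_point X a) (space_point X b) (mdist (C X) a b)"
  using chain.in_space[OF chain.refl[OF space_point_in_pts]] by fastforce

lemma chain_edge:
  "edge u v \<Longrightarrow> s \<in> {0..1} \<Longrightarrow> t \<in> {0..1} \<Longrightarrow> ch (edge_point u v s) (edge_point u v t) \<bar>s - t\<bar>"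
  using chain.in_edge[OF chain.refl[OF edge_point_in_pts]] by fastforce

lemma chain_trans: "ch y z M \<Longrightarrow> ch x y L \<Longrightarrow> ch x z (L + M)"
proof (induction arbitrary: L rule: chain.induct)
  case (in_space y X a M b)
  then show ?case using chain.in_space[of Y C p \<xi> K x X a "L + M" b] by (simp add: add.assoc)
next
  case (in_edge y u v s M t)
  then show ?case using chain.in_edge[of Y C p \<xi> K x u v s "L + M" t] by (simp add: add.assoc)
qed simp

lemma chain_sym: "ch x y L \<Longrightarrow> ch y x L"
proof (induction rule: chain.induct)
  case (in_space x X a L b)
  then show ?case
    using chain_trans[OF in_space.IH chain_space[of X b a]] mdist_sym[of "C X" a b] by (simp add: add.commute)
next
  case (in_edge x u v s L t)
  then show ?case
    using chain_trans[OF in_edge.IH chain_edge[of u v t s]] by (simp add: add.commute abs_minus_commute)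
qed (simp add: chain.refl)

text \<open>A path of indices lifts to a chain because projections are nonempty: each step walks
  inside a piece to a projection point and crosses one edge. Without a chain the infimum in
  \<open>BBF_dist\<close> would be over the empty set.\<close>

lemma chain_ex:
  assumes "x \<in> pts" "y \<in> pts"
  shows "\<exists>L. ch x y L"
proof -
  have adj: "\<exists>b L. b \<in> mspace (C Z) \<and> ch (space_point X a) (space_point Z b) L"
    if "E X Z" "a \<in> mspace (C X)" for X Z a
  proof -
    have Y: "X \<in> Y" "Z \<in> Y" "X \<noteq> Z" using that by (auto simp: E_iff)
    then obtain x z where xz: "x \<in> p X Z" "z \<in> p Z X" using p_nonempty by (metis ex_in_conv)
    then have e: "edge (X, x) (Z, z)" using that by (auto simp: BBF_edge_def)
    have "ch (space_point X a) (space_point X x) (mdist (C X) a x)"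
      using xz Y that p_subset[of X Z] by (intro chain_space) auto
    moreover have "ch (space_point X x) (space_point Z z) 1"
      using chain_edge[OF e, of 0 1] by simp
    ultimately show ?thesis using chain_trans xz Y p_subset[of Z X] by blast
  qed
  have ex: "\<exists>b L. b \<in> mspace (C Z) \<and> ch (space_point X a) (space_point Z b) L"
    if "E\<^sup>*\<^sup>* X Z" "X \<in> Y" "a \<in> mspace (C X)" for X Z a
    using that
  proof (induction rule: rtranclp_induct)
    case base
    then show ?case using chain.refl[OF space_point_in_pts] by blast
  next
    case (step V Z)
    then show ?case using adj[of V Z] chain_trans by blast
  qed
  have v: "\<exists>u\<in>verts. \<exists>L. ch q (vpoint u) L" if "q \<in> pts" for q
    using that
  proof (cases rule: pts_cases)
    case (vertex u)
    then show ?thesis using chain.refl[OF vpoint_in_pts] by blast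
  next
    case (edge u v t)
    then have "ch q (vpoint u) \<bar>t - 0\<bar>" using chain_edge[of u v t 0] by simp
    then show ?thesis using edgeD edge by blast
  qed
  obtain u L where u: "u \<in> verts" "ch x (vpoint u) L" using v assms by blast
  obtain w M where w: "w \<in> verts" "ch y (vpoint w) M" using v assms by blast
  obtain b N where b: "b \<in> mspace (C (fst w))" "ch (vpoint u) (space_point (fst w) b) N"
    using ex[OF PK_connected, of "fst u" "fst w" "snd u"] u w by (auto simp: verts_def)
  have "ch (space_point (fst w) b) (vpoint w) (mdist (C (fst w)) b (snd w))"
    using b w by (intro chain_space) (auto simp: verts_def)
  then show ?thesis using u b chain_sym[OF w(2)] chain_trans by blast
qed

lemma d_le: "ch x y L \<Longrightarrow> d x y \<le> L"
  using chain_pts unfolding BBF_dist_def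
  by (auto intro!: cInf_lower bdd_belowI[where m = 0] dest: chain_pts)

lemma d_nonneg: "0 \<le> d x y"
  unfolding BBF_dist_def using chain_ex[of x y] chain_pts[of x y] by (auto intro!: cInf_greatest)

lemma d_approx:
  assumes "x \<in> pts" "y \<in> pts" "0 < e"
  shows "\<exists>L. ch x y L \<and> L < d x y + e"
proof -
  have "{L. ch x y L} \<noteq> {}" using chain_ex assms by auto
  then show ?thesis
    using cInf_lessD[of "{L. ch x y L}" "d x y + e"] assms by (auto simp: BBF_dist_def)
qed

lemma d_sym: "d x y = d y x"
proof -
  have "{L. ch x y L} = {L. ch y x L}" using chain_sym by blast
  then show ?thesis by (auto simp: BBF_dist_def)
qed

lemma d_triangle:
  assumes "x \<in> pts" "y \<in> pts" "z \<in> pts"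
  shows "d x z \<le> d x y + d y z"
proof (rule field_le_epsilon)
  fix e :: real assume e: "0 < e"
  obtain L where L: "ch x y L" "L < d x y + e / 2" using d_approx[of x y "e / 2"] assms e by auto
  obtain M where M: "ch y z M" "M < d y z + e / 2" using d_approx[of y z "e / 2"] assms e by auto
  show "d x z \<le> d x y + d y z + e" using d_le[OF chain_trans[OF M(1) L(1)]] L M by simp
qed

lemma d_space_le: "X \<in> Y \<Longrightarrow> a \<in> mspace (C X) \<Longrightarrow> b \<in> mspace (C X)
    \<Longrightarrow> d (space_point X a) (space_point X b) \<le> mdist (C X) a b"
  by (rule d_le[OF chain_space])

lemma d_edge_le: "edge u v \<Longrightarrow> s \<in> {0..1} \<Longrightarrow> t \<in> {0..1}
    \<Longrightarrow> d (edge_point u v s) (edge_point u v t) \<le> \<bar>s - t\<bar>"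
  by (rule d_le[OF chain_edge])

lemma d_supp_le:
  assumes "q \<in> pts" "u \<in> supp q"
  shows "d q (vpoint u) \<le> 1"
  using assms(1)
proof (cases rule: pts_cases)
  case (vertex v)
  then show ?thesis using assms d_le[OF chain.refl] by force
next
  case (edge v w t)
  then have "u = v \<or> u = w" using assms supp_edge_point_subset by blast
  then show ?thesis using edge d_edge_le[of v w t 0] d_edge_le[of v w t 1] by auto
qed

text \<open>As points are barycentric weights, \<open>ext \<phi>\<close> interpolates \<open>\<phi>\<close> affinely along the edges.\<close>

definition ext :: "('i \<times> 'a \<Rightarrow> real) \<Rightarrow> ('i, 'a) point \<Rightarrow> real" where
  "ext \<phi> q = (\<Sum>w\<in>supp q. q w * \<phi> w)"

lemma ext_vpoint [simp]: "ext \<phi> (vpoint u) = \<phi> u" "ext \<phi> (space_point X a) = \<phi> (X, a)"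
  by (simp_all add: ext_def) (simp_all add: space_point_def)

lemma ext_edge_point:
  assumes "u \<noteq> v"
  shows "ext \<phi> (edge_point u v t) = (1 - t) * \<phi> u + t * \<phi> v"
proof -
  have "ext \<phi> (edge_point u v t) = (\<Sum>w\<in>{u, v}. edge_point u v t w * \<phi> w)"
    unfolding ext_def using supp_edge_point_subset
    by (intro sum.mono_neutral_left) (auto simp: supp_def)
  then show ?thesis using assms by (simp add: edge_point_def)
qed

text \<open>The source of lower bounds for \<open>d\<close>, an infimum over chains: a bound for
  each kind of step adds up along any chain.\<close>

lemma ext_lipschitz:
  assumes "0 \<le> c"
    and "\<And>X a b. X \<in> Y \<Longrightarrow> a \<in> mspace (C X) \<Longrightarrow> b \<in> mspace (C X)
        \<Longrightarrow> \<bar>\<phi> (X, a) - \<phi> (X, b)\<bar> \<le> c * mdist (C X) a b"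
    and "\<And>u v. edge u v \<Longrightarrow> \<bar>\<phi> u - \<phi> v\<bar> \<le> c"
    and "x \<in> pts" "y \<in> pts"
  shows "\<bar>ext \<phi> x - ext \<phi> y\<bar> \<le> c * d x y"
proof -
  have chain: "\<bar>ext \<phi> x - ext \<phi> y\<bar> \<le> c * L" if "ch x y L" for L
    using that
  proof (induction rule: chain.induct)
    case (in_space x X a L b)
    then show ?case using assms(2)[of X a b] by (simp add: distrib_left)
  next
    case (in_edge x u v s L t)
    have ne: "u \<noteq> v" using edgeD(3)[OF in_edge.hyps(2)] by auto
    have "\<bar>ext \<phi> (edge_point u v s) - ext \<phi> (edge_point u v t)\<bar> = \<bar>(s - t) * (\<phi> v - \<phi> u)\<bar>"
      unfolding ext_edge_point[OF ne] by (simp add: algebra_simps)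
    also have "\<dots> \<le> c * \<bar>s - t\<bar>"
      using assms(3)[OF in_edge.hyps(2)] mult_right_mono[of "\<bar>\<phi> v - \<phi> u\<bar>" c "\<bar>s - t\<bar>"]
      by (simp add: abs_mult abs_minus_commute mult.commute)
    finally show ?case using in_edge.IH by (simp add: distrib_left)
  qed simp
  show ?thesis
  proof (rule field_le_epsilon)
    fix e :: real assume e: "0 < e"
    \<comment> \<open>The denominator is \<open>c + 1\<close> so that \<open>c = 0\<close> is
      covered.\<close>
    have pos: "0 < e / (c + 1)" using assms(1) e by simp
    obtain L where L: "ch x y L" "L < d x y + e / (c + 1)" using d_approx[OF assms(4,5) pos] by auto
    have "c * L \<le> c * (d x y + e / (c + 1))" using L assms(1) by (intro mult_left_mono) auto
    also have "\<dots> \<le> c * d x y + e" using assms(1) e by (simp add: field_simps)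
    finally show "\<bar>ext \<phi> x - ext \<phi> y\<bar> \<le> c * d x y + e" using chain[OF L(1)] by simp
  qed
qed

text \<open>Steep bumps around a vertex recover the barycentric weights, which therefore coincide for
  points at distance 0.\<close>

lemma d_zero_imp_eq:
  assumes "x \<in> pts" "y \<in> pts" "d x y = 0"
  shows "x = y"
proof
  fix u
  show "x u = y u"
  proof (cases "u \<in> verts")
    case False
    then have "u \<notin> supp x" "u \<notin> supp y" using assms supp_pts by blast+
    then show ?thesis by (simp add: supp_def)
  next
    case True
    obtain X a where u: "u = (X, a)" "X \<in> Y" "a \<in> mspace (C X)" using True by (auto simp: verts_def)
    define F where "F = {w \<in> supp x \<union> supp y. fst w = X \<and> w \<noteq> u}"
    \<comment> \<open>Steep enough for the bump at \<open>u\<close> to vanish at every vertex of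
      \<open>F\<close>. The summand 1 makes \<open>n\<close> at least as large as the jump of the
      bump across an edge.\<close>
    define n where "n = 1 + (\<Sum>w\<in>F. 1 / mdist (C X) (snd w) a)"
    define \<phi> where "\<phi> = (\<lambda>w. if fst w = X then max 0 (1 - n * mdist (C X) (snd w) a) else 0)"
    have F: "finite F" using supp_pts assms by (auto simp: F_def)
    have n: "1 \<le> n" using sum_nonneg[of F "\<lambda>w. 1 / mdist (C X) (snd w) a"] by (simp add: n_def)
    have far: "1 \<le> n * mdist (C X) (snd w) a" if "w \<in> F" for w
    proof -
      have "snd w \<in> mspace (C X)" "snd w \<noteq> a"
        using that supp_pts(3)[OF assms(1)] supp_pts(3)[OF assms(2)] u
        by (cases w; auto simp: F_def verts_def)+
      then have pos: "0 < mdist (C X) (snd w) a"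
        using u Metric_space.mdist_pos_less[OF Metric_space_mspace_mdist] by metis
      have "1 / mdist (C X) (snd w) a \<le> (\<Sum>w\<in>F. 1 / mdist (C X) (snd w) a)"
        using member_le_sum[OF that, of "\<lambda>w. 1 / mdist (C X) (snd w) a"] F by simp
      then have "1 / mdist (C X) (snd w) a \<le> n" by (simp add: n_def)
      then show ?thesis using pos by (simp add: field_simps)
    qed
    have "mdist (C X) a a = 0" using u by simp
    note this [simp]
    have "\<phi> u = 1" using u(1) by (simp add: \<phi>_def)
    have ext: "ext \<phi> q = q u" if "q \<in> pts" "supp q \<subseteq> supp x \<union> supp y" for q
    proof -
      have zero: "\<phi> w = 0" if "w \<in> supp q" "w \<noteq> u" for w
        using far[of w] that \<open>supp q \<subseteq> _\<close> by (auto simp: \<phi>_def F_def)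
      have "ext \<phi> q = (\<Sum>w\<in>supp q. if w = u then q u else 0)"
        unfolding ext_def using zero \<open>\<phi> u = 1\<close> by (intro sum.cong) auto
      also have "\<dots> = (if u \<in> supp q then q u else 0)"
        using supp_pts(1)[OF that(1)] by (simp add: sum.delta)
      finally show ?thesis by (simp add: supp_def split: if_splits)
    qed
    have "\<bar>ext \<phi> x - ext \<phi> y\<bar> \<le> n * d x y"
    proof (rule ext_lipschitz)
      fix Z b b' assume Z: "Z \<in> Y" "b \<in> mspace (C Z)" "b' \<in> mspace (C Z)"
      show "\<bar>\<phi> (Z, b) - \<phi> (Z, b')\<bar> \<le> n * mdist (C Z) b b'"
      proof (cases "Z = X")
        case True
        have "\<bar>mdist (C X) b a - mdist (C X) b' a\<bar> \<le> mdist (C X) b b'"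
          using mdist_triangle[of b "C X" b' a] mdist_triangle[of b' "C X" b a] mdist_sym[of "C X" b b']
            Z u True by auto
        then have "\<bar>n * mdist (C X) b a - n * mdist (C X) b' a\<bar> \<le> n * mdist (C X) b b'"
          using n by (simp flip: right_diff_distrib add: abs_mult)
        then show ?thesis using True by (auto simp: \<phi>_def)
      qed (use n in \<open>simp add: \<phi>_def\<close>)
    next
      fix v w assume "edge v w"
      have "0 \<le> \<phi> w \<and> \<phi> w \<le> 1" for w
        using n by (auto simp: \<phi>_def)
      from this[of v] this[of w] show "\<bar>\<phi> v - \<phi> w\<bar> \<le> n" using n by linarith
    qed (use assms n in auto)
    then show ?thesis using assms ext[of x] ext[of y] by simp
  qed
qed

lemma metric_space: "Metric_space pts d"
proof
  show "d x y = 0 \<longleftrightarrow> x = y" if "x \<in> pts" "y \<in> pts" for x y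
    using d_zero_imp_eq that d_le[OF chain.refl[OF that(1)]] d_nonneg[of x x] by force
qed (use d_nonneg d_sym d_triangle in auto)

abbreviation S :: "('i, 'a) point metric" where "S \<equiv> BBF_space Y C p \<xi> K"

lemma mspace_S [simp]: "mspace S = pts"
  unfolding BBF_space_def by (rule Metric_space.mspace_metric[OF metric_space])

lemma mdist_S [simp]: "mdist S = d"
  unfolding BBF_space_def by (rule Metric_space.mdist_metric[OF metric_space])

section \<open>Chains as Lipschitz paths\<close>

definition lip_path :: "('i, 'a) point \<Rightarrow> ('i, 'a) point \<Rightarrow> real \<Rightarrow> bool" where
  "lip_path x y l \<longleftrightarrow> (\<exists>\<gamma>. 0 \<le> l \<and> \<gamma> 0 = x \<and> \<gamma> l = y \<and> \<gamma> ` {0..l} \<subseteq> pts \<and>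
     (\<forall>s\<in>{0..l}. \<forall>t\<in>{0..l}. d (\<gamma> s) (\<gamma> t) \<le> \<bar>s - t\<bar>))"

lemma lip_path_trans:
  assumes "lip_path x y l" "lip_path y z m"
  shows "lip_path x z (l + m)"
proof -
  obtain \<gamma> where \<gamma>: "0 \<le> l" "\<gamma> 0 = x" "\<gamma> l = y" "\<And>s. s \<in> {0..l} \<Longrightarrow> \<gamma> s \<in> pts"
    "\<And>s t. s \<in> {0..l} \<Longrightarrow> t \<in> {0..l} \<Longrightarrow> d (\<gamma> s) (\<gamma> t) \<le> \<bar>s - t\<bar>"
    using assms(1) unfolding lip_path_def by blast
  obtain \<eta> where \<eta>: "0 \<le> m" "\<eta> 0 = y" "\<eta> m = z" "\<And>s. s \<in> {0..m} \<Longrightarrow> \<eta> s \<in> pts"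
    "\<And>s t. s \<in> {0..m} \<Longrightarrow> t \<in> {0..m} \<Longrightarrow> d (\<eta> s) (\<eta> t) \<le> \<bar>s - t\<bar>"
    using assms(2) unfolding lip_path_def by blast
  define \<zeta> where "\<zeta> = (\<lambda>t. if t \<le> l then \<gamma> t else \<eta> (t - l))"
  have in_pts: "\<zeta> s \<in> pts" if "s \<in> {0..l + m}" for s
    using that \<gamma>(4) \<eta>(4) by (auto simp: \<zeta>_def)
  have mixed: "d (\<zeta> s) (\<zeta> t) \<le> t - s" if "0 \<le> s" "s \<le> l" "l < t" "t \<le> l + m" for s t
    using that \<gamma>(5)[of s l] \<eta>(5)[of 0 "t - l"] d_triangle[of "\<gamma> s" y "\<eta> (t - l)"]
      \<gamma>(1,3) \<eta>(1,2) \<gamma>(4)[of s] \<gamma>(4)[of l] \<eta>(4)[of "t - l"] by (auto simp: \<zeta>_def)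
  have "d (\<zeta> s) (\<zeta> t) \<le> \<bar>s - t\<bar>" if "s \<in> {0..l + m}" "t \<in> {0..l + m}" for s t
  proof -
    consider "s \<le> l" "t \<le> l" | "l < s" "l < t" | "s \<le> l" "l < t" | "t \<le> l" "l < s" by linarith
    then show ?thesis
    proof cases
      case 1
      then show ?thesis using \<gamma>(5)[of s t] that by (auto simp: \<zeta>_def)
    next
      case 2
      then show ?thesis using \<eta>(5)[of "s - l" "t - l"] that by (auto simp: \<zeta>_def)
    next
      case 3
      then show ?thesis using mixed[of s t] that by auto
    next
      case 4
      then show ?thesis using mixed[of t s] that d_sym[of "\<zeta> s"] by auto
    qed
  qed
  moreover have "\<zeta> 0 = x" "\<zeta> (l + m) = z"
    using \<gamma>(1,2,3) \<eta>(1,2,3) by (auto simp: \<zeta>_def)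
  ultimately show ?thesis
    unfolding lip_path_def using in_pts \<gamma>(1) \<eta>(1) by (intro exI[of _ \<zeta>]) auto
qed

lemma chain_lip_path: "ch x y L \<Longrightarrow> lip_path x y L"
proof (induction rule: chain.induct)
  case (refl x)
  then show ?case
    unfolding lip_path_def using d_le[OF chain.refl] by (intro exI[of _ "\<lambda>_. x"]) auto
next
  case (in_space x X a L b)
  obtain l \<sigma> where \<sigma>: "geodesic_path (C X) l \<sigma>" "\<sigma> 0 = a" "\<sigma> l = b"
    using system in_space.hyps unfolding projection_system_def geodesic_metric_def by meson
  have l: "0 \<le> l" "l = mdist (C X) a b" using \<sigma> by (auto simp: geodesic_path_def)
  have "lip_path (space_point X a) (space_point X b) l"
    unfolding lip_path_def
  proof (intro exI[of _ "\<lambda>t. space_point X (\<sigma> t)"] conjI ballI)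
    show "(\<lambda>t. space_point X (\<sigma> t)) ` {0..l} \<subseteq> pts"
      using \<sigma> in_space.hyps by (auto simp: geodesic_path_def intro!: space_point_in_pts)
    fix s t assume "s \<in> {0..l}" "t \<in> {0..l}"
    then show "d (space_point X (\<sigma> s)) (space_point X (\<sigma> t)) \<le> \<bar>s - t\<bar>"
      using d_space_le[of X "\<sigma> s" "\<sigma> t"] \<sigma> in_space.hyps by (auto simp: geodesic_path_def image_subset_iff)
  qed (use \<sigma> l in auto)
  then show ?case using lip_path_trans[OF in_space.IH] l by simp
next
  case (in_edge x u v s L t)
  define \<sigma> where "\<sigma> = (\<lambda>h::real. if s \<le> t then s + h else s - h)"
  have \<sigma>: "\<sigma> h \<in> {0..1}" if "h \<in> {0..\<bar>s - t\<bar>}" for h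
    using that in_edge.hyps by (auto simp: \<sigma>_def)
  have "lip_path (edge_point u v s) (edge_point u v t) \<bar>s - t\<bar>"
    unfolding lip_path_def
  proof (intro exI[of _ "\<lambda>h. edge_point u v (\<sigma> h)"] conjI ballI)
    show "(\<lambda>h. edge_point u v (\<sigma> h)) ` {0..\<bar>s - t\<bar>} \<subseteq> pts"
      using \<sigma> edge_point_in_pts in_edge.hyps by blast
    fix h k assume "h \<in> {0..\<bar>s - t\<bar>}" "k \<in> {0..\<bar>s - t\<bar>}"
    then have "d (edge_point u v (\<sigma> h)) (edge_point u v (\<sigma> k)) \<le> \<bar>\<sigma> h - \<sigma> k\<bar>"
      using d_edge_le[of u v] \<sigma> in_edge.hyps by blast
    also have "\<dots> = \<bar>h - k\<bar>" by (auto simp: \<sigma>_def)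
    finally show "d (edge_point u v (\<sigma> h)) (edge_point u v (\<sigma> k)) \<le> \<bar>h - k\<bar>" .
  qed (auto simp: \<sigma>_def)
  then show ?case using lip_path_trans[OF in_edge.IH] by simp
qed

lemma path_metric_S: "path_metric S"
  unfolding path_metric_def mspace_S mdist_S
proof (intro ballI allI impI)
  fix x y and e :: real assume "x \<in> pts" "y \<in> pts" "0 < e"
  then obtain L where "ch x y L" "L < d x y + e" using d_approx by blast
  then show "\<exists>l \<gamma>. 0 \<le> l \<and> l < d x y + e \<and> \<gamma> 0 = x \<and> \<gamma> l = y \<and> \<gamma> ` {0..l} \<subseteq> pts \<and>
     (\<forall>s\<in>{0..l}. \<forall>t\<in>{0..l}. d (\<gamma> s) (\<gamma> t) \<le> \<bar>s - t\<bar>)"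
    using chain_lip_path[of x y L] unfolding lip_path_def by blast
qed

section \<open>Relative hyperbolicity\<close>

abbreviation pc :: "'i \<Rightarrow> ('i, 'a) point set" where "pc \<equiv> piece C"

lemma pc_iff: "q \<in> pc W \<longleftrightarrow> (\<exists>a\<in>mspace (C W). q = space_point W a)"
  by (auto simp: piece_def)

lemma pc_subset: "W \<in> Y \<Longrightarrow> pc W \<subseteq> pts"
  by (auto simp: pc_iff space_point_in_pts)

lemma nbhdI: "x \<in> pts \<Longrightarrow> w \<in> A \<Longrightarrow> d x w \<le> \<rho> \<Longrightarrow> x \<in> nbhd S \<rho> A"
  unfolding nbhd_def using d_nonneg
  by (auto intro!: cINF_lower2[where x = w] bdd_belowI2[where m = 0])

lemma nbhdD:
  assumes "x \<in> nbhd S \<rho> A" "\<rho> < \<rho>'"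
  shows "x \<in> pts" "\<exists>w\<in>A. d x w < \<rho>'"
proof -
  have x: "x \<in> pts" "A \<noteq> {}" "(INF a\<in>A. d x a) \<le> \<rho>" using assms(1) by (auto simp: nbhd_def)
  then have "(INF a\<in>A. d x a) < \<rho>'" using assms(2) by simp
  then show "\<exists>w\<in>A. d x w < \<rho>'"
    using x(2) d_nonneg by (subst (asm) cINF_less_iff) (auto intro!: bdd_belowI2[where m = 0])
qed (use assms in \<open>auto simp: nbhd_def\<close>)

definition far :: "real \<Rightarrow> 'i \<Rightarrow> ('i, 'a) point \<Rightarrow> bool" where
  "far \<rho> W q \<longleftrightarrow> (\<forall>w\<in>pc W. \<rho> < d q w)"

lemma not_nbhd_far: "x \<in> pts \<Longrightarrow> x \<notin> nbhd S \<rho> (pc W) \<Longrightarrow> far \<rho> W x"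
  unfolding far_def using nbhdI by (meson not_less)

lemma far_move:
  assumes "far \<rho> W x" "W \<in> Y" "x \<in> pts" "y \<in> pts" "d x y \<le> t" "\<rho>' \<le> \<rho> - t"
  shows "far \<rho>' W y"
  unfolding far_def
proof
  fix w assume w: "w \<in> pc W"
  then have "\<rho> < d x w" "d x w \<le> d x y + d y w"
    using assms pc_subset[OF assms(2)] d_triangle[OF assms(3,4), of w] by (auto simp: far_def)
  then show "\<rho>' < d y w" using assms by simp
qed

lemma far_vertex:
  assumes "far \<rho> W (vpoint u)" "u \<in> verts" "0 \<le> \<rho>"
  shows "fst u \<noteq> W"
proof
  assume "fst u = W"
  then have "vpoint u \<in> pc W" using assms(2) by (auto simp: pc_iff verts_def)
  then have "\<rho> < d (vpoint u) (vpoint u)" using assms(1) by (auto simp: far_def)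
  then show False using d_le[OF chain.refl[OF vpoint_in_pts[OF assms(2)]]] assms(3) by simp
qed

section \<open>Projections of vertices to a piece\<close>

definition lip :: real where "lip = K + 2 * r + 2"

lemma lip_ge: "2 \<le> lip" using K_ge r_nonneg by (simp add: lip_def)

text \<open>A chosen point instead of a set: vertices with a common index other than
  \<open>W\<close> have the same image, so the diameter of \<open>p W X\<close> does not
  enter.\<close>

definition prj :: "'i \<Rightarrow> 'i \<times> 'a \<Rightarrow> ('i, 'a) point" where
  "prj W u = (if fst u = W then vpoint u else space_point W (SOME a. a \<in> p W (fst u)))"

lemma prj_cases:
  assumes "W \<in> Y" "u \<in> verts" "fst u \<noteq> W"
  obtains a where "a \<in> p W (fst u)" "a \<in> mspace (C W)" "prj W u = space_point W a"
proof -
  have Y: "fst u \<in> Y" using assms by (auto simp: verts_def)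
  have "(SOME a. a \<in> p W (fst u)) \<in> p W (fst u)"
    using p_nonempty[of W "fst u"] assms Y by (simp add: some_in_eq)
  then show ?thesis using that p_subset[of W "fst u"] assms Y by (auto simp: prj_def)
qed

lemma prj_in_pts: "W \<in> Y \<Longrightarrow> u \<in> verts \<Longrightarrow> prj W u \<in> pts"
  by (cases "fst u = W") (metis prj_def vpoint_in_pts, metis prj_cases space_point_in_pts)

lemma prj_eq: "fst u = fst v \<Longrightarrow> fst u \<noteq> W \<Longrightarrow> prj W u = prj W v"
  by (simp add: prj_def)

lemma d_prj_le_D:
  assumes "W \<in> Y" "u \<in> verts" "v \<in> verts" "fst u \<noteq> W" "fst v \<noteq> W"
  shows "d (prj W u) (prj W v) \<le> D W (fst u) (fst v)"
proof -
  obtain a where a: "a \<in> p W (fst u)" "a \<in> mspace (C W)" "prj W u = space_point W a"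
    using prj_cases assms by metis
  obtain b where b: "b \<in> p W (fst v)" "b \<in> mspace (C W)" "prj W v = space_point W b"
    using prj_cases assms by metis
  have "mdist (C W) a b \<le> D W (fst u) (fst v)"
    using assms a b by (intro mdist_le_D) (auto simp: verts_def)
  then show ?thesis using d_space_le[of W a b] assms a b by simp
qed

lemma d_refl: "x \<in> pts \<Longrightarrow> d x x = 0"
  using d_le[OF chain.refl] d_nonneg[of x x] by force

lemma d_edge_ends: "edge u v \<Longrightarrow> d (vpoint u) (vpoint v) \<le> 1"
  using d_edge_le[of u v 0 1] by simp

text \<open>For adjacent \<open>W\<close> and \<open>X\<close>, two points of \<open>p W X\<close> are at distance at most 2, however large
  the diameter of \<open>p W X\<close> may be: both are joined to the points of \<open>p X W\<close>.\<close>

lemma d_prj_own: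
  assumes "edge u v" "fst u = W"
  shows "d (prj W u) (prj W v) \<le> 2"
proof -
  note e = edgeD[OF assms(1)]
  obtain a where a: "a \<in> p W (fst v)" "a \<in> mspace (C W)" "prj W v = space_point W a"
    using prj_cases[of W v] e assms(2) by metis
  have e': "edge (W, a) v" using assms a by (auto simp: BBF_edge_def)
  have "d (vpoint u) (space_point W a) \<le> d (vpoint u) (vpoint v) + d (vpoint v) (space_point W a)"
    using e a assms by (intro d_triangle) (auto intro: vpoint_in_pts space_point_in_pts)
  also have "\<dots> \<le> 2"
    using d_edge_ends[OF assms(1)] d_edge_ends[OF e'] d_sym[of "vpoint v"] by simp
  finally show ?thesis using a assms by (simp add: prj_def)
qed

text \<open>Two bounds meet in \<open>lip\<close>: K + 2 * r for edges away from \<open>W\<close>,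
  whose adjacent indices are close as seen from \<open>W\<close>, and 2 for edges at
  \<open>W\<close>.\<close>

lemma d_prj_edge:
  assumes "W \<in> Y" "edge u v"
  shows "d (prj W u) (prj W v) \<le> lip"
proof -
  note e = edgeD[OF assms(2)]
  consider "fst u = W" | "fst v = W" | "fst u \<noteq> W" "fst v \<noteq> W" by auto
  then show ?thesis
  proof cases
    case 1
    then show ?thesis using d_prj_own[OF assms(2)] lip_ge by simp
  next
    case 2
    then show ?thesis using d_prj_own[OF e(5)] lip_ge d_sym[of "prj W u"] by simp
  next
    case 3
    then have "D W (fst u) (fst v) \<le> K + 2 * r" using E_D_le[OF e(4)] assms by auto
    then show ?thesis using d_prj_le_D[of W u v] e 3 assms(1) by (simp add: lip_def)
  qed
qed

text \<open>With the distance to \<open>prj W u\<close> as test function,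
  \<open>ext_lipschitz\<close> reduces the claim to single pieces and edges.\<close>

lemma d_prj_lip:
  assumes "W \<in> Y" "u \<in> verts" "v \<in> verts"
  shows "d (prj W u) (prj W v) \<le> lip * d (vpoint u) (vpoint v)"
proof -
  define \<phi> where "\<phi> = (\<lambda>w. d (prj W u) (prj W w))"
  have diff: "\<bar>\<phi> w - \<phi> w'\<bar> \<le> d (prj W w) (prj W w')" if "w \<in> verts" "w' \<in> verts" for w w'
    using d_triangle[of "prj W u" "prj W w" "prj W w'"] d_triangle[of "prj W u" "prj W w'" "prj W w"]
      d_sym[of "prj W w"] prj_in_pts assms that by (auto simp: \<phi>_def)
  have "\<bar>ext \<phi> (vpoint u) - ext \<phi> (vpoint v)\<bar> \<le> lip * d (vpoint u) (vpoint v)"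
  proof (rule ext_lipschitz)
    fix X a b assume X: "X \<in> Y" "a \<in> mspace (C X)" "b \<in> mspace (C X)"
    then have ab: "(X, a) \<in> verts" "(X, b) \<in> verts" by (auto simp: verts_def)
    have "d (prj W (X, a)) (prj W (X, b)) \<le> mdist (C X) a b"
    proof (cases "X = W")
      case True
      then show ?thesis using d_space_le X by (simp add: prj_def)
    next
      case False
      then have "d (prj W (X, a)) (prj W (X, b)) = 0"
        using prj_eq[of "(X, a)" "(X, b)" W] d_refl[OF prj_in_pts] ab assms by simp
      then show ?thesis by simp
    qed
    also have "\<dots> \<le> lip * mdist (C X) a b"
      using mult_right_mono[of 1 lip "mdist (C X) a b"] lip_ge by simp
    finally show "\<bar>\<phi> (X, a) - \<phi> (X, b)\<bar> \<le> lip * mdist (C X) a b" using diff[OF ab] by simp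
  next
    fix w w' assume e: "edge w w'"
    show "\<bar>\<phi> w - \<phi> w'\<bar> \<le> lip"
      using diff[OF edgeD(1,2)[OF e]] d_prj_edge[OF assms(1) e] by simp
  qed (use lip_ge assms vpoint_in_pts in auto)
  then show ?thesis using d_refl[OF prj_in_pts] assms d_nonneg[of "prj W u"] by (simp add: \<phi>_def)
qed

lemma d_prj_near:
  assumes "W \<in> Y" "x \<in> pts" "u \<in> supp x" "w \<in> pc W" "d x w \<le> \<rho>"
  shows "d x (prj W u) \<le> \<rho> + lip * (\<rho> + 1)" "d w (prj W u) \<le> lip * (\<rho> + 1)"
proof -
  obtain a where a: "a \<in> mspace (C W)" "w = vpoint (W, a)" using assms(4) by (auto simp: pc_iff)
  have u: "u \<in> verts" using supp_pts assms by auto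
  have v: "(W, a) \<in> verts" "prj W (W, a) = w" using a assms by (auto simp: verts_def prj_def)
  have pts: "w \<in> pts" "vpoint u \<in> pts" "prj W u \<in> pts"
    using v u a assms by (auto intro: space_point_in_pts vpoint_in_pts prj_in_pts)
  have "d w (vpoint u) \<le> \<rho> + 1"
    using d_triangle[of w x "vpoint u"] d_supp_le[OF assms(2,3)] d_sym[of w x] assms pts by simp
  then have "lip * d w (vpoint u) \<le> lip * (\<rho> + 1)" using lip_ge by simp
  then show *: "d w (prj W u) \<le> lip * (\<rho> + 1)" using d_prj_lip[OF assms(1) v(1) u] v a by simp
  then show "d x (prj W u) \<le> \<rho> + lip * (\<rho> + 1)"
    using d_triangle[of x w "prj W u"] assms pts by simp
qed

section \<open>Edges and chains far from a piece\<close>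

lemma cross_edge:
  assumes "E V W" "Z \<in> Y" "Z \<noteq> V" "a \<in> p V Z" "D V Z W \<le> t"
  shows "\<exists>b\<in>p W V. d (space_point V a) (space_point W b) \<le> t + 1"
proof -
  have Y: "V \<in> Y" "W \<in> Y" "V \<noteq> W" using assms by (auto simp: E_iff)
  obtain a' b where ab: "a' \<in> p V W" "b \<in> p W V" using p_nonempty Y by (metis ex_in_conv)
  have in_C: "a \<in> mspace (C V)" "a' \<in> mspace (C V)" "b \<in> mspace (C W)"
    using assms ab Y p_subset[of V Z] p_subset[of V W] p_subset[of W V] by auto
  have "mdist (C V) a a' \<le> t" using mdist_le_D[of V Z W a a'] assms ab Y by auto
  then have "d (space_point V a) (space_point V a') \<le> t" using d_space_le[of V a a'] in_C Y by simp
  moreover have "d (space_point V a') (space_point W b) \<le> 1"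
    using d_edge_ends[of "(V, a')" "(W, b)"] ab assms by (simp add: BBF_edge_def)
  ultimately show ?thesis
    using d_triangle[of "space_point V a" "space_point V a'" "space_point W b"] in_C Y ab
      space_point_in_pts by (intro bexI[of _ b]) auto
qed

text \<open>If neither end of the edge bars the other, \<open>adjacent_separator\<close> offers a
  neighbour \<open>V\<close> of \<open>W\<close> that bars \<open>X\<close>. Where this fails to
  give a link, \<open>cross_edge\<close> builds a route from an end of the edge to the piece of
  \<open>W\<close> that is too short for the hypotheses.\<close>

lemma edge_link:
  assumes "W \<in> Y" "edge u v" "far (9 * r + 2) W (vpoint u)" "far (9 * r + 2) W (vpoint v)"
  shows "link W (fst u) (fst v)"
proof -
  note e = edgeD[OF assms(2)]
  define X where "X = fst u"
  define Z where "Z = fst v"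
  have XZ: "X \<in> Y" "Z \<in> Y" "X \<noteq> Z" "E X Z" "snd u \<in> p X Z" "snd v \<in> p Z X"
    using e by (auto simp: X_def Z_def)
  have W: "X \<noteq> W" "Z \<noteq> W"
    using far_vertex assms e r_nonneg by (force simp: X_def Z_def)+
  have in_pc: "space_point W b \<in> pc W" if "b \<in> p W V" "V \<in> Y" "V \<noteq> W" for b V
    using that p_subset[of W V] assms(1) by (auto simp: pc_iff)
  consider "8 * r < D X Z W" | "8 * r < D Z X W" | "D X Z W \<le> 8 * r" "D Z X W \<le> 8 * r" by linarith
  then have "link W X Z"
  proof cases
    case 1
    then show ?thesis
      using XZ W assms(1) unfolding link_def by (intro exI[of _ X]) (auto simp: bars_def)
  next
    case 2
    then show ?thesis
      using XZ W assms(1) unfolding link_def by (intro exI[of _ Z]) (auto simp: bars_def)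
  next
    case 3
    \<comment> \<open>From \<open>u\<close>, an edge to the piece of \<open>W\<close> would be
      reached at cost 8 * r and crossed at cost 1.\<close>
    have "\<not> E X W"
    proof
      assume "E X W"
      then obtain b where "b \<in> p W X" "d (vpoint u) (space_point W b) \<le> 8 * r + 1"
        using cross_edge[of X W Z "snd u" "8 * r"] XZ 3 by (auto simp: X_def)
      then show False using assms(3) in_pc[of b X] XZ W r_nonneg by (force simp: far_def)
    qed
    then obtain V where V: "V \<noteq> X" "E V W" "K < D V X W"
      using adjacent_separator[of X W] XZ W assms(1) by auto
    then have VY: "V \<in> Y" "V \<noteq> W" by (auto simp: E_iff)
    have VZ: "V \<noteq> Z" using V 3 K_ge r_nonneg by auto
    \<comment> \<open>Otherwise \<open>V\<close> sees \<open>X\<close> and \<open>Z\<close> more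
      than K - 8 * r \<ge> 4 * r apart, so \<open>E_between\<close> makes it adjacent to
      \<open>Z\<close>. The route from \<open>v\<close> over \<open>V\<close> to \<open>W\<close>
      then costs (r + 1) + (8 * r + 1).\<close>
    have "8 * r < D V Z W"
    proof (rule ccontr)
      assume "\<not> 8 * r < D V Z W"
      then have small: "D V Z W \<le> 8 * r" by simp
      then have "4 * r < D V X Z"
        using D_triangle[of V X Z W] V VY VZ XZ W assms(1) K_ge by auto
      then have EZ: "E Z V" and "D Z X V \<le> r"
        using E_between(2)[of X Z V] behrstock(1)[of V X Z] XZ V VY VZ r_nonneg E_sym by auto
      then obtain b where b: "b \<in> p V Z" "d (vpoint v) (space_point V b) \<le> r + 1"
        using cross_edge[of Z V X "snd v" r] XZ by (auto simp: Z_def)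
      obtain w where w: "w \<in> p W V" "d (space_point V b) (space_point W w) \<le> 8 * r + 1"
        using cross_edge[of V W Z b "8 * r"] V(2) XZ VZ b small by auto
      have "d (vpoint v) (space_point W w) \<le> 9 * r + 2"
        using d_triangle[of "vpoint v" "space_point V b" "space_point W w"] b w e VY XZ VZ
          p_subset[of V Z] p_subset[of W V] assms(1)
        by (fastforce intro: vpoint_in_pts space_point_in_pts)
      then show False using assms(4) in_pc[OF w(1)] VY by (force simp: far_def)
    qed
    then show ?thesis
      using V VY VZ XZ W assms(1) K_ge r_nonneg unfolding link_def
      by (intro exI[of _ V]) (auto simp: bars_def)
  qed
  then show ?thesis by (simp add: X_def Z_def)
qed

lemma link_supp:
  assumes "W \<in> Y" "q \<in> pts" "far (9 * r + 3) W q" "A \<in> supp q" "B \<in> supp q"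
  shows "link W (fst A) (fst B)"
proof -
  have near: "far (9 * r + 2) W (vpoint u)" if "u \<in> supp q" for u
    using far_move[OF assms(3,1,2) _ d_supp_le[OF assms(2) that]] supp_pts(3)[OF assms(2)] that
    by (force intro: vpoint_in_pts)
  have ne: "fst A \<noteq> W" "fst A \<in> Y"
    using far_vertex[OF near[OF assms(4)]] supp_pts(3)[OF assms(2)] assms(4) r_nonneg
    by (auto simp: verts_def)
  show ?thesis
    using assms(2)
  proof (cases rule: pts_cases)
    case (vertex u)
    then show ?thesis using assms ne link_refl by auto
  next
    case (edge u v t)
    then have s: "supp q = {u, v}" using edgeD(3)[OF edge(1)] by (subst edge(4), subst supp_edge_point) auto
    then have "link W (fst u) (fst v)" using edge_link[OF assms(1) edge(1)] near by auto
    then show ?thesis using s assms(1,4,5) ne link_refl link_sym by fastforce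
  qed
qed

text \<open>A chain shorter than 1 stays within 1 of \<open>x\<close>, and the ends of its edges
  within 2, which turns 9 * r + 4 into the 9 * r + 2 of \<open>edge_link\<close>. Steps inside a
  piece keep the index.\<close>

lemma chain_link:
  assumes "ch x y L" "L < 1" "W \<in> Y" "far (9 * r + 4) W x" "A \<in> supp x" "B \<in> supp y"
  shows "(link W)\<^sup>*\<^sup>* (fst A) (fst B)"
  using assms
proof (induction arbitrary: B rule: chain.induct)
  case (refl x)
  have "far (9 * r + 3) W x"
    using far_move[of "9 * r + 4" W x x 1 "9 * r + 3"] refl d_refl[of x] by auto
  then show ?case using link_supp[of W x A B] refl by auto
next
  case (in_space x X a L b)
  then have "L < 1" by (smt (verit) mdist_nonneg)
  then have "(link W)\<^sup>*\<^sup>* (fst A) (fst (X, a))" using in_space by (intro in_space.IH) auto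
  then show ?case using in_space.prems by simp
next
  case (in_edge x u v s L t)
  note e = edgeD[OF in_edge.hyps(2)]
  have L: "L < 1" using in_edge.prems by linarith
  have pts: "x \<in> pts" "edge_point u v s \<in> pts" using chain_pts[OF in_edge.hyps(1)] by auto
  have "d x (edge_point u v s) \<le> 1" using d_le[OF in_edge.hyps(1)] L by simp
  then have f: "far (9 * r + 3) W (edge_point u v s)"
    using far_move[OF in_edge.prems(3,2) pts, of 1 "9 * r + 3"] by simp
  have "d (edge_point u v s) (vpoint u) \<le> 1" "d (edge_point u v s) (vpoint v) \<le> 1"
    using d_edge_le[of u v s 0] d_edge_le[of u v s 1] in_edge.hyps by auto
  then have near: "far (9 * r + 2) W (vpoint u)" "far (9 * r + 2) W (vpoint v)"
    using far_move[OF f in_edge.prems(2) pts(2)] e vpoint_in_pts by force+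
  then have ne: "fst u \<noteq> W" "fst v \<noteq> W" using far_vertex e r_nonneg by force+
  have uv: "link W (fst u) (fst v)" using edge_link[OF in_edge.prems(2) in_edge.hyps(2)] near by simp
  obtain B' where B': "B' \<in> supp (edge_point u v s)" using supp_pts(2)[OF pts(2)] by auto
  then have "(link W)\<^sup>*\<^sup>* (fst A) (fst B')" using in_edge L by blast
  moreover have "B \<in> {u, v}" "B' \<in> {u, v}" using B' in_edge.prems supp_edge_point_subset by blast+
  then have "link W (fst B') (fst B)"
    using uv link_sym[OF uv] link_refl in_edge.prems e ne by auto
  ultimately show ?case by simp
qed

section \<open>Continuous paths far from a piece\<close>

definition cpath :: "real \<Rightarrow> (real \<Rightarrow> ('i, 'a) point) \<Rightarrow> bool" where
  "cpath l \<gamma> \<longleftrightarrow> 0 \<le> l \<and> \<gamma> ` {0..l} \<subseteq> pts \<and>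
     (\<forall>t\<in>{0..l}. \<forall>e>0. \<exists>\<delta>>0. \<forall>s\<in>{0..l}. \<bar>s - t\<bar> < \<delta> \<longrightarrow> d (\<gamma> t) (\<gamma> s) < e)"

lemma cpathD:
  assumes "cpath l \<gamma>"
  shows "0 \<le> l" "\<And>t. t \<in> {0..l} \<Longrightarrow> \<gamma> t \<in> pts"
    "\<And>t e. t \<in> {0..l} \<Longrightarrow> 0 < e \<Longrightarrow> \<exists>\<delta>>0. \<forall>s\<in>{0..l}. \<bar>s - t\<bar> < \<delta> \<longrightarrow> d (\<gamma> t) (\<gamma> s) < e"
  using assms by (auto simp: cpath_def)

lemma almost_geodesic_cpath:
  assumes "almost_geodesic S \<mu> c l \<gamma>"
  shows "cpath l \<gamma>"
  unfolding cpath_def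
proof (intro conjI ballI allI impI)
  show l: "0 \<le> l" and img: "\<gamma> ` {0..l} \<subseteq> pts"
    using assms by (auto simp: almost_geodesic_def quasi_geodesic_def)
  fix t and e :: real assume t: "t \<in> {0..l}" and e: "0 < e"
  have "openin (mtopology_of S) (mball_of S (\<gamma> t) e)"
    unfolding mtopology_of_def mball_of_def
    by (rule Metric_space.openin_mball[OF Metric_space_mspace_mdist])
  then have "openin (top_of_set {0..l}) {s \<in> topspace (top_of_set {0..l}). \<gamma> s \<in> mball_of S (\<gamma> t) e}"
    using assms unfolding almost_geodesic_def by (blast intro: openin_continuous_map_preimage)
  then have "openin (top_of_set {0..l}) {s \<in> {0..l}. \<gamma> s \<in> mball_of S (\<gamma> t) e}"
    by (simp only: topspace_euclidean_subtopology)
  moreover have "t \<in> {s \<in> {0..l}. \<gamma> s \<in> mball_of S (\<gamma> t) e}"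
    using t e img d_refl[of "\<gamma> t"] by (auto simp: image_subset_iff)
  ultimately obtain \<delta> where "0 < \<delta>" "\<And>s. s \<in> {0..l} \<Longrightarrow> dist s t < \<delta> \<Longrightarrow> \<gamma> s \<in> mball_of S (\<gamma> t) e"
    unfolding openin_euclidean_subtopology_iff by blast
  then show "\<exists>\<delta>>0. \<forall>s\<in>{0..l}. \<bar>s - t\<bar> < \<delta> \<longrightarrow> d (\<gamma> t) (\<gamma> s) < e"
    by (intro exI[of _ \<delta>]) (auto simp: dist_real_def)
qed

lemma geodesic_path_cpath:
  assumes "geodesic_path S l \<gamma>"
  shows "cpath l \<gamma>"
  unfolding cpath_def
proof (intro conjI ballI allI impI)
  show "0 \<le> l" "\<gamma> ` {0..l} \<subseteq> pts" using assms by (auto simp: geodesic_path_def)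
  fix t and e :: real assume "t \<in> {0..l}" "0 < e"
  then show "\<exists>\<delta>>0. \<forall>s\<in>{0..l}. \<bar>s - t\<bar> < \<delta> \<longrightarrow> d (\<gamma> t) (\<gamma> s) < e"
    using assms by (intro exI[of _ e]) (auto simp: geodesic_path_def abs_minus_commute)
qed

text \<open>Times with linked indices form an equivalence relation that holds locally, by
  \<open>chain_link\<close>; connectedness of the segment makes it hold throughout, without a
  subdivision. With \<open>closed_segment\<close> the path may also be run backwards, as exit points
  require.\<close>

lemma path_barrier:
  assumes "cpath l \<gamma>" "W \<in> Y" "s \<in> {0..l}" "t \<in> {0..l}"
    and avoid: "\<And>h. h \<in> closed_segment s t \<Longrightarrow> \<gamma> h \<notin> nbhd S (9 * r + 5) (pc W)"
    and A: "A \<in> supp (\<gamma> s)" and B: "B \<in> supp (\<gamma> t)"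
  shows "\<exists>U. bars W (6 * r) U (fst A) \<and> bars W (6 * r) U (fst B)"
proof -
  define R where
    "R = (\<lambda>h k. \<forall>A\<in>supp (\<gamma> h). \<forall>B\<in>supp (\<gamma> k). (link W)\<^sup>*\<^sup>* (fst A) (fst B))"
  have seg: "closed_segment s t \<subseteq> {0..l}"
    using assms(3,4) by (simp add: closed_segment_subset)
  have pts: "\<gamma> h \<in> pts" if "h \<in> closed_segment s t" for h using cpathD(2)[OF assms(1)] that seg by auto
  have far4: "far (9 * r + 4) W (\<gamma> h)" if "h \<in> closed_segment s t" for h
    using not_nbhd_far[OF pts avoid] that by (force simp: far_def)
  have "R s t"
  proof (rule connected_equivalence_relation[of "closed_segment s t"])
    show "R k h" if "R h k" for h k using that rtranclp_link_sym unfolding R_def by blast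
    show "R h m" if "R h k" "R k m" "h \<in> closed_segment s t" "k \<in> closed_segment s t" for h k m
      using that supp_pts(2)[OF pts[OF that(4)]] unfolding R_def by (meson all_not_in_conv rtranclp_trans)
  next
    fix h assume h: "h \<in> closed_segment s t"
    obtain \<delta> where \<delta>: "0 < \<delta>" "\<And>k. k \<in> {0..l} \<Longrightarrow> \<bar>k - h\<bar> < \<delta> \<Longrightarrow> d (\<gamma> h) (\<gamma> k) < 1"
      using cpathD(3)[OF assms(1), of h 1] h seg by (meson subsetD zero_less_one)
    show "\<exists>T. openin (top_of_set (closed_segment s t)) T \<and> h \<in> T \<and> (\<forall>k\<in>T. R h k)"
    proof (intro exI[of _ "closed_segment s t \<inter> ball h \<delta>"] conjI ballI)
      show "openin (top_of_set (closed_segment s t)) (closed_segment s t \<inter> ball h \<delta>)"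
        by (simp add: openin_open_Int)
      fix k assume k: "k \<in> closed_segment s t \<inter> ball h \<delta>"
      then have "d (\<gamma> h) (\<gamma> k) < 1" using \<delta>(2)[of k] seg by (auto simp: dist_real_def abs_minus_commute)
      then obtain L where "ch (\<gamma> h) (\<gamma> k) L" "L < 1"
        using d_approx[of "\<gamma> h" "\<gamma> k" "1 - d (\<gamma> h) (\<gamma> k)"] pts h k by auto
      then show "R h k" unfolding R_def using chain_link assms(2) far4[OF h] by blast
    qed (use h \<delta> in auto)
  qed auto
  then have "(link W)\<^sup>*\<^sup>* (fst A) (fst B)" using A B by (auto simp: R_def)
  moreover have Av: "A \<in> verts" using supp_pts(3)[OF pts[of s]] A by auto
  moreover have "far (9 * r + 3) W (vpoint A)"
    using far_move[OF far4[of s] assms(2) pts[of s] vpoint_in_pts[OF Av] d_supp_le[OF pts[of s] A]] by simp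
  then have "fst A \<noteq> W" using far_vertex Av r_nonneg by force
  ultimately show ?thesis using rtranclp_link_barrier assms(2) by (auto simp: verts_def)
qed

lemma barrier_prj:
  assumes "bars W (6 * r) U (fst A)" "bars W (6 * r) U (fst B)" "A \<in> verts" "B \<in> verts"
  shows "d (prj W A) (prj W B) \<le> 2 * r"
proof (cases "fst A = fst B")
  case True
  then show ?thesis
    using prj_eq[of A B W] d_refl[OF prj_in_pts] assms r_nonneg by (auto simp: bars_def)
next
  case False
  have "D W (fst A) (fst B) \<le> 2 * r" using barrier_D_le[OF assms(1,2) False] r_nonneg by simp
  then show ?thesis using d_prj_le_D[of W A B] assms by (auto simp: bars_def)
qed

section \<open>The conditions \<open>alpha1\<close> and \<open>alpha2\<close>\<close>

lemma alpha1_S: "alpha1 S (pc ` Y)"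
  unfolding alpha1_def
proof (intro allI)
  fix \<rho>0 :: real
  define \<rho> where "\<rho> = \<bar>\<rho>0\<bar> + 1"
  define B where "B = 2 * (\<rho> + lip * (2 * \<rho> + 1))"
  have \<rho>: "1 \<le> \<rho>" by (simp add: \<rho>_def)
  have main: "mdiam S (nbhd S \<rho>0 (pc W) \<inter> nbhd S \<rho>0 (pc X)) \<le> ereal B"
    if WX: "W \<in> Y" "X \<in> Y" "W \<noteq> X" for W X
  proof (rule mdiam_le)
    show "0 \<le> B" using \<rho> lip_ge by (simp add: B_def)
    have close: "\<exists>u\<in>verts. fst u = X \<and> d x (prj W u) \<le> \<rho> + lip * (2 * \<rho> + 1)"
      if x: "x \<in> nbhd S \<rho>0 (pc W) \<inter> nbhd S \<rho>0 (pc X)" for x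
    proof -
      have xp: "x \<in> pts" using x by (auto simp: nbhd_def)
      have "\<rho>0 < \<rho>" by (simp add: \<rho>_def)
      then obtain w q where w: "w \<in> pc W" "d x w < \<rho>" and q: "q \<in> pc X" "d x q < \<rho>"
        using nbhdD(2) x by (meson IntD1 IntD2)
      then obtain b where b: "b \<in> mspace (C X)" "q = vpoint (X, b)" by (auto simp: pc_iff)
      have u: "(X, b) \<in> verts" using b WX by (auto simp: verts_def)
      have pts: "w \<in> pts" "q \<in> pts" "prj W (X, b) \<in> pts"
        using w q WX pc_subset prj_in_pts u by auto
      have "d q w \<le> 2 * \<rho>" using d_triangle[of q x w] d_sym[of q x] w q pts xp by simp
      then have "d w (prj W (X, b)) \<le> lip * (2 * \<rho> + 1)"
        using d_prj_near(2)[of W q "(X, b)" w "2 * \<rho>"] WX pts w b by simp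
      then show ?thesis using d_triangle[of x w "prj W (X, b)"] w pts xp u by (intro bexI[of _ "(X, b)"]) auto
    qed
    fix x y assume x: "x \<in> nbhd S \<rho>0 (pc W) \<inter> nbhd S \<rho>0 (pc X)"
      and y: "y \<in> nbhd S \<rho>0 (pc W) \<inter> nbhd S \<rho>0 (pc X)"
    obtain u v where u: "u \<in> verts" "fst u = X" "d x (prj W u) \<le> \<rho> + lip * (2 * \<rho> + 1)"
      and v: "v \<in> verts" "fst v = X" "d y (prj W v) \<le> \<rho> + lip * (2 * \<rho> + 1)"
      using close[OF x] close[OF y] by blast
    \<comment> \<open>Both points are close to one and the same projection point, which is why
      \<open>B\<close> can be independent of \<open>W\<close> and \<open>X\<close>.\<close>
    then have "prj W u = prj W v" using prj_eq WX by simp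
    then show "mdist S x y \<le> B"
      using d_triangle[of x "prj W u" y] d_sym[of "prj W u" y] u v prj_in_pts[OF WX(1) u(1)] x y
      by (auto simp: B_def nbhd_def)
  qed
  show "\<exists>B::real. \<forall>P\<in>pc ` Y. \<forall>Q\<in>pc ` Y. P \<noteq> Q \<longrightarrow>
     mdiam S (nbhd S \<rho>0 P \<inter> nbhd S \<rho>0 Q) \<le> ereal B"
    using main by blast
qed

lemma alpha2_S: "alpha2 S (pc ` Y)"
proof -
  \<comment> \<open>With this \<epsilon> the two ends contribute half of \<open>d x y\<close>, up to
    a constant, to its estimate through the projections, and this half is absorbed.\<close>
  define \<epsilon> where "\<epsilon> = 1 / (4 * (1 + lip))"
  define M where "M = 8 * lip + 9 * r + 5"
  have \<epsilon>: "0 < \<epsilon>" "\<epsilon> < 1 / 2" "(1 + lip) * \<epsilon> = 1 / 4" using lip_ge by (auto simp: \<epsilon>_def field_simps)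
  have M: "0 \<le> M" "9 * r + 5 \<le> M" using lip_ge r_nonneg by (auto simp: M_def)
  have "\<gamma> ` {0..l} \<inter> nbhd S M (pc W) \<noteq> {}"
    if W: "W \<in> Y" and x: "x \<in> nbhd S (\<epsilon> * d x y) (pc W)" and y: "y \<in> nbhd S (\<epsilon> * d x y) (pc W)"
      and \<gamma>: "geodesic_path S l \<gamma>" "\<gamma> 0 = x" "\<gamma> l = y" for W x y l \<gamma>
  proof
    assume disj: "\<gamma> ` {0..l} \<inter> nbhd S M (pc W) = {}"
    note cp = geodesic_path_cpath[OF \<gamma>(1)]
    have xy: "x \<in> pts" "y \<in> pts" using x y by (auto simp: nbhd_def)
    have l: "0 \<le> l" using \<gamma> by (auto simp: geodesic_path_def)
    obtain A B where AB: "A \<in> supp x" "B \<in> supp y" using supp_pts(2) xy by blast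
    have v: "A \<in> verts" "B \<in> verts" using AB supp_pts(3) xy by auto
    have mono: "nbhd S (9 * r + 5) (pc W) \<subseteq> nbhd S M (pc W)" using M(2) by (auto simp: nbhd_def)
    have "\<exists>U. bars W (6 * r) U (fst A) \<and> bars W (6 * r) U (fst B)"
    proof (rule path_barrier[OF cp W, of 0 l])
      fix h assume "h \<in> closed_segment 0 l"
      then have "h \<in> {0..l}" using l by (simp add: closed_segment_eq_real_ivl)
      then show "\<gamma> h \<notin> nbhd S (9 * r + 5) (pc W)" using disj mono by blast
    qed (use l \<gamma> AB in auto)
    then have AB': "d (prj W A) (prj W B) \<le> 2 * r" using barrier_prj v by blast
    have near: "d z (prj W u) \<le> (1 + lip) * \<epsilon> * d x y + (1 + 2 * lip)"
      if z: "z \<in> nbhd S (\<epsilon> * d x y) (pc W)" "u \<in> supp z" for z u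
    proof -
      obtain w where "w \<in> pc W" "d z w < \<epsilon> * d x y + 1"
        using nbhdD(2)[OF z(1), of "\<epsilon> * d x y + 1"] by auto
      then show ?thesis
        using d_prj_near(1)[OF W _ z(2), of w "\<epsilon> * d x y + 1"] z(1)
        by (auto simp: algebra_simps nbhd_def)
    qed
    have pts: "prj W A \<in> pts" "prj W B \<in> pts" using prj_in_pts W v by auto
    have "d x y \<le> d x (prj W A) + d (prj W A) (prj W B) + d (prj W B) y"
      using d_triangle[of x "prj W A" y] d_triangle[of "prj W A" "prj W B" y] xy pts by simp
    then have "d x y \<le> 2 * (d x y / 4 + (1 + 2 * lip)) + 2 * r"
      using near[OF x AB(1)] near[OF y AB(2)] AB' d_sym[of "prj W B" y] \<epsilon>(3) by simp
    \<comment> \<open>A geodesic that avoids the neighbourhood is thus so short that \<epsilon> * d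
      x y \<le> M, which puts its own end \<open>x\<close> into it.\<close>
    then have "d x y \<le> 4 + 8 * lip + 4 * r" by simp
    moreover have "\<epsilon> * d x y \<le> 1 * d x y" using \<epsilon> d_nonneg[of x y] by (intro mult_right_mono) auto
    ultimately have "\<epsilon> * d x y \<le> M" using r_nonneg by (simp add: M_def)
    then have "x \<in> nbhd S M (pc W)" using x by (auto simp: nbhd_def)
    then show False using disj \<gamma> l by force
  qed
  then show ?thesis
    unfolding alpha2_def mdist_S using \<epsilon> M by (intro exI[of _ \<epsilon>] exI[of _ M]) blast
qed

section \<open>Triangles, entrance and exit points\<close>

definition N :: "'i \<Rightarrow> ('i, 'a) point set" where "N W = nbhd S (9 * r + 5) (pc W)"

definition err :: real where "err = 9 * r + 9 + lip * (9 + 9 * r) + 2 * r"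

text \<open>While the path avoids \<open>N W\<close>, its projection stays within 2 * r of
  \<open>prj W A\<close>; close to \<tau> it is near the piece and hence near its own projection.
  Hits are assumed only at times arbitrarily close to \<tau>, so that \<tau> may be an infimum or a
  supremum.\<close>

lemma first_hit_near_prj:
  assumes cp: "cpath l \<gamma>" and W: "W \<in> Y" and st: "s \<in> {0..l}" "\<tau> \<in> {0..l}"
    and avoid: "\<And>t. t \<in> closed_segment s \<tau> \<Longrightarrow> t \<noteq> \<tau> \<Longrightarrow> \<gamma> t \<notin> N W"
    and hit: "\<And>e. 0 < e \<Longrightarrow> \<exists>t\<in>{0..l}. \<bar>t - \<tau>\<bar> < e \<and> \<gamma> t \<in> N W"
    and A: "A \<in> supp (\<gamma> s)"
  shows "d (\<gamma> \<tau>) (prj W A) \<le> err"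
proof -
  have pts: "\<gamma> t \<in> pts" if "t \<in> {0..l}" for t using cpathD(2)[OF cp] that by auto
  obtain \<delta> where \<delta>: "0 < \<delta>" "\<And>k. k \<in> {0..l} \<Longrightarrow> \<bar>k - \<tau>\<bar> < \<delta> \<Longrightarrow> d (\<gamma> \<tau>) (\<gamma> k) < 1"
    using cpathD(3)[OF cp st(2), of 1] by auto
  obtain t1 where t1: "t1 \<in> {0..l}" "\<bar>t1 - \<tau>\<bar> < \<delta>" "\<gamma> t1 \<in> N W" using hit[OF \<delta>(1)] by auto
  obtain w where w: "w \<in> pc W" "d (\<gamma> t1) w < 9 * r + 6"
    using nbhdD(2)[of "\<gamma> t1" "9 * r + 5" "pc W" "9 * r + 6"] t1 by (auto simp: N_def)
  have wp: "w \<in> pts" using w W pc_subset by auto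
  have \<tau>w: "d (\<gamma> \<tau>) w \<le> 9 * r + 7"
    using d_triangle[of "\<gamma> \<tau>" "\<gamma> t1" w] \<delta>(2)[OF t1(1,2)] w pts st t1 wp by simp
  show ?thesis
  proof (cases "s = \<tau>")
    case True
    have "lip * (9 * r + 7 + 1) \<le> lip * (9 + 9 * r)" using lip_ge by simp
    then show ?thesis
      using d_prj_near(1)[OF W pts[OF st(2)] _ w(1) \<tau>w, of A] A True r_nonneg by (simp add: err_def)
  next
    case False
    \<comment> \<open>\<open>t0\<close> lies on the side of \<open>s\<close>, within \<delta> of
      \<tau> but different from it, so that the closed segment from \<open>s\<close> to
      \<open>t0\<close> avoids \<open>N W\<close>.\<close>
    define \<eta> where "\<eta> = min 1 (\<delta> / (2 * \<bar>s - \<tau>\<bar>))"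
    define t0 where "t0 = \<tau> + \<eta> * (s - \<tau>)"
    have \<eta>: "0 < \<eta>" "\<eta> \<le> 1" using \<delta> False by (auto simp: \<eta>_def)
    have "\<eta> * \<bar>s - \<tau>\<bar> \<le> \<delta> / (2 * \<bar>s - \<tau>\<bar>) * \<bar>s - \<tau>\<bar>"
      by (intro mult_right_mono) (auto simp: \<eta>_def)
    also have "\<dots> < \<delta>" using \<delta> False by simp
    finally have t0\<tau>: "\<bar>t0 - \<tau>\<bar> < \<delta>" using \<eta> by (simp add: t0_def abs_mult)
    have t0seg: "t0 \<in> closed_segment s \<tau>"
      unfolding in_segment t0_def using \<eta> by (intro exI[of _ "1 - \<eta>"]) (auto simp: algebra_simps)
    have t0: "t0 \<in> {0..l}" "t0 \<noteq> \<tau>"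
      using t0seg st closed_segment_subset[of s "{0..l}" \<tau>] \<eta> False by (auto simp: t0_def)
    have sub: "closed_segment s t0 \<subseteq> closed_segment s \<tau> - {\<tau>}"
    proof -
      have "\<tau> \<notin> closed_segment s t0"
        using t0seg t0(2) False by (auto simp: closed_segment_eq_real_ivl split: if_splits)
      then show ?thesis using t0seg subset_closed_segment[of s t0 s \<tau>] by auto
    qed
    have d1: "d (\<gamma> \<tau>) (\<gamma> t0) < 1" using \<delta>(2)[OF t0(1) t0\<tau>] .
    obtain B where B: "B \<in> supp (\<gamma> t0)" using supp_pts(2)[OF pts[OF t0(1)]] by auto
    have v: "A \<in> verts" "B \<in> verts" using A B supp_pts(3)[OF pts] st t0 by auto
    have "\<exists>U. bars W (6 * r) U (fst A) \<and> bars W (6 * r) U (fst B)"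
      using path_barrier[OF cp W st(1) t0(1) _ A B] avoid sub by (auto simp: N_def)
    then have AB: "d (prj W B) (prj W A) \<le> 2 * r"
      using barrier_prj[OF _ _ v] d_sym[of "prj W B" "prj W A"] by auto
    have "d (\<gamma> t0) w \<le> 9 * r + 8"
      using d_triangle[of "\<gamma> t0" "\<gamma> \<tau>" w] d_sym[of "\<gamma> t0"] d1 \<tau>w pts st t0 wp by simp
    then have "d (\<gamma> t0) (prj W B) \<le> 9 * r + 8 + lip * (9 * r + 8 + 1)"
      by (rule d_prj_near(1)[OF W pts[OF t0(1)] B w(1)])
    then show ?thesis
      using d_triangle[of "\<gamma> \<tau>" "\<gamma> t0" "prj W A"] d_triangle[of "\<gamma> t0" "prj W B" "prj W A"]
        d1 AB pts st t0 prj_in_pts[OF W] v by (simp add: err_def)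
  qed
qed

lemma entrance_near_prj:
  assumes cp: "cpath l \<gamma>" and W: "W \<in> Y" and meets: "\<gamma> ` {0..l} \<inter> N W \<noteq> {}" and A: "A \<in> supp (\<gamma> 0)"
  shows "entrance_point l \<gamma> (N W) \<in> pts" "d (entrance_point l \<gamma> (N W)) (prj W A) \<le> err"
proof -
  define T where "T = {t \<in> {0..l}. \<gamma> t \<in> N W}"
  have T: "T \<noteq> {}" "bdd_below T" using meets by (auto simp: T_def intro: bdd_belowI)
  have l: "0 \<le> l" using cpathD(1)[OF cp] .
  obtain t1 where t1: "t1 \<in> T" using T by auto
  have \<tau>: "Inf T \<in> {0..l}"
    using cInf_lower[OF t1 T(2)] t1 cInf_greatest[OF T(1), of 0] by (auto simp: T_def)
  have "d (\<gamma> (Inf T)) (prj W A) \<le> err"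
  proof (rule first_hit_near_prj[OF cp W, of 0])
    fix t assume t: "t \<in> closed_segment 0 (Inf T)" "t \<noteq> Inf T"
    then have "t < Inf T" "t \<in> {0..l}" using \<tau> by (auto simp: closed_segment_eq_real_ivl)
    then show "\<gamma> t \<notin> N W" using cInf_lower[of t T] T(2) by (auto simp: T_def)
  next
    fix e :: real assume "0 < e"
    then obtain t where "t \<in> T" "t < Inf T + e" using cInf_lessD[OF T(1), of "Inf T + e"] by auto
    moreover have "Inf T \<le> t" using cInf_lower[OF _ T(2)] calculation by auto
    ultimately have "t \<in> T" "\<bar>t - Inf T\<bar> < e" by auto
    then show "\<exists>t\<in>{0..l}. \<bar>t - Inf T\<bar> < e \<and> \<gamma> t \<in> N W"
      by (intro bexI[of _ t]) (auto simp: T_def)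
  qed (use l \<tau> A in auto)
  then show "d (entrance_point l \<gamma> (N W)) (prj W A) \<le> err" "entrance_point l \<gamma> (N W) \<in> pts"
    using cpathD(2)[OF cp \<tau>] by (auto simp: entrance_point_def T_def)
qed

lemma exit_near_prj:
  assumes cp: "cpath l \<gamma>" and W: "W \<in> Y" and meets: "\<gamma> ` {0..l} \<inter> N W \<noteq> {}" and A: "A \<in> supp (\<gamma> l)"
  shows "exit_point l \<gamma> (N W) \<in> pts" "d (exit_point l \<gamma> (N W)) (prj W A) \<le> err"
proof -
  define T where "T = {t \<in> {0..l}. \<gamma> t \<in> N W}"
  have T: "T \<noteq> {}" "bdd_above T" using meets by (auto simp: T_def intro: bdd_aboveI)
  have l: "0 \<le> l" using cpathD(1)[OF cp] .
  obtain t1 where t1: "t1 \<in> T" using T by auto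
  have \<tau>: "Sup T \<in> {0..l}"
    using cSup_upper[OF t1 T(2)] t1 cSup_least[OF T(1), of l] by (auto simp: T_def)
  have "d (\<gamma> (Sup T)) (prj W A) \<le> err"
  proof (rule first_hit_near_prj[OF cp W, of l])
    fix t assume t: "t \<in> closed_segment l (Sup T)" "t \<noteq> Sup T"
    then have "Sup T < t" "t \<in> {0..l}" using \<tau> by (auto simp: closed_segment_eq_real_ivl split: if_splits)
    then show "\<gamma> t \<notin> N W" using cSup_upper[of t T] T(2) by (auto simp: T_def)
  next
    fix e :: real assume "0 < e"
    then obtain t where "t \<in> T" "Sup T - e < t" using less_cSupD[OF T(1), of "Sup T - e"] by auto
    moreover have "t \<le> Sup T" using cSup_upper[OF _ T(2)] calculation by auto
    ultimately have "t \<in> T" "\<bar>t - Sup T\<bar> < e" by auto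
    then show "\<exists>t\<in>{0..l}. \<bar>t - Sup T\<bar> < e \<and> \<gamma> t \<in> N W"
      by (intro bexI[of _ t]) (auto simp: T_def)
  qed (use l \<tau> A in auto)
  then show "d (exit_point l \<gamma> (N W)) (prj W A) \<le> err" "exit_point l \<gamma> (N W) \<in> pts"
    using cpathD(2)[OF cp \<tau>] by (auto simp: exit_point_def T_def)
qed

lemma side_meets:
  assumes cp: "cpath l \<gamma>" and W: "W \<in> Y" and A: "A \<in> supp (\<gamma> 0)" and B: "B \<in> supp (\<gamma> l)"
    and no_barrier: "\<And>U. bars W (6 * r) U (fst A) \<Longrightarrow> bars W (6 * r) U (fst B) \<Longrightarrow> False"
  shows "\<gamma> ` {0..l} \<inter> N W \<noteq> {}"
proof
  assume disj: "\<gamma> ` {0..l} \<inter> N W = {}"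
  have l: "0 \<le> l" using cpathD(1)[OF cp] .
  have "\<exists>U. bars W (6 * r) U (fst A) \<and> bars W (6 * r) U (fst B)"
    using path_barrier[OF cp W, of 0 l A B] A B disj l
    by (force simp: N_def closed_segment_eq_real_ivl)
  then show False using no_barrier by blast
qed

text \<open>No two of the three corners have a common barrier from the centre: \<open>sep\<close>
  excludes it for the two sides at the first corner, \<open>ex_centre\<close> for the opposite side.
  At each corner the exit from one side and the entrance to the next are within \<open>err\<close>
  of the same projection point, whence 2 * err.\<close>

lemma asymp_tree_graded_S: "asymp_tree_graded S (pc ` Y)"
  unfolding asymp_tree_graded_def
proof (intro allI impI, rule exI[of _ "9 * r + 5"], rule exI[of _ "2 * err"], intro allI impI disjI2)
  fix c l1 l2 l3 :: real and \<gamma>1 \<gamma>2 \<gamma>3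
  assume "almost_geodesic S 1 c l1 \<gamma>1 \<and> almost_geodesic S 1 c l2 \<gamma>2 \<and> almost_geodesic S 1 c l3 \<gamma>3 \<and>
     \<gamma>1 l1 = \<gamma>2 0 \<and> \<gamma>2 l2 = \<gamma>3 0 \<and> \<gamma>3 l3 = \<gamma>1 0"
  then have cp: "cpath l1 \<gamma>1" "cpath l2 \<gamma>2" "cpath l3 \<gamma>3"
    and ends: "\<gamma>1 l1 = \<gamma>2 0" "\<gamma>2 l2 = \<gamma>3 0" "\<gamma>3 l3 = \<gamma>1 0"
    using almost_geodesic_cpath by auto
  have pts: "\<gamma>1 0 \<in> pts" "\<gamma>2 0 \<in> pts" "\<gamma>3 0 \<in> pts" using cpathD(1,2)[OF cp(1)] cpathD(1,2)[OF cp(2)] cpathD(1,2)[OF cp(3)] by auto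
  obtain a b e where abe: "a \<in> supp (\<gamma>1 0)" "b \<in> supp (\<gamma>2 0)" "e \<in> supp (\<gamma>3 0)"
    using supp_pts(2)[OF pts(1)] supp_pts(2)[OF pts(2)] supp_pts(2)[OF pts(3)] by (meson all_not_in_conv)
  have v: "a \<in> verts" "b \<in> verts" "e \<in> verts"
    using abe supp_pts(3)[OF pts(1)] supp_pts(3)[OF pts(2)] supp_pts(3)[OF pts(3)] by auto
  then have Y: "fst a \<in> Y" "fst b \<in> Y" "fst e \<in> Y" by (auto simp: verts_def)
  obtain W where W: "W \<in> Y" "sep W (fst a) (fst b)" "sep W (fst a) (fst e)"
    "\<not> (\<exists>U. bars W (6 * r) U (fst b) \<and> bars W (6 * r) U (fst e))"
    using ex_centre[OF Y] by blast
  have meets: "\<gamma>1 ` {0..l1} \<inter> N W \<noteq> {}" "\<gamma>2 ` {0..l2} \<inter> N W \<noteq> {}" "\<gamma>3 ` {0..l3} \<inter> N W \<noteq> {}"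
    using side_meets[OF cp(1) W(1), of a b] side_meets[OF cp(2) W(1), of b e]
      side_meets[OF cp(3) W(1), of e a] abe ends sep_no_barrier[OF W(2)] sep_no_barrier[OF W(3)] W(4)
    by auto
  have close: "d x y \<le> 2 * err" if "x \<in> pts" "y \<in> pts" "u \<in> verts" "d x (prj W u) \<le> err" "d y (prj W u) \<le> err"
    for x y u
    using d_triangle[of x "prj W u" y] d_sym[of y] prj_in_pts[OF W(1)] that by auto
  note en = entrance_near_prj[OF _ W(1)] and ex = exit_near_prj[OF _ W(1)]
  have "d (exit_point l1 \<gamma>1 (N W)) (entrance_point l2 \<gamma>2 (N W)) \<le> 2 * err"
    "d (exit_point l2 \<gamma>2 (N W)) (entrance_point l3 \<gamma>3 (N W)) \<le> 2 * err"
    "d (exit_point l3 \<gamma>3 (N W)) (entrance_point l1 \<gamma>1 (N W)) \<le> 2 * err"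
    using close[OF ex(1)[OF cp(1) meets(1), of b] en(1)[OF cp(2) meets(2), of b] v(2)]
      close[OF ex(1)[OF cp(2) meets(2), of e] en(1)[OF cp(3) meets(3), of e] v(3)]
      close[OF ex(1)[OF cp(3) meets(3), of a] en(1)[OF cp(1) meets(1), of a] v(1)]
      ex(2)[OF cp(1) meets(1), of b] en(2)[OF cp(2) meets(2), of b]
      ex(2)[OF cp(2) meets(2), of e] en(2)[OF cp(3) meets(3), of e]
      ex(2)[OF cp(3) meets(3), of a] en(2)[OF cp(1) meets(1), of a] abe ends by auto
  then show "\<exists>P\<in>pc ` Y. let N = nbhd S (9 * r + 5) P in
          \<gamma>1 ` {0..l1} \<inter> N \<noteq> {} \<and> \<gamma>2 ` {0..l2} \<inter> N \<noteq> {} \<and> \<gamma>3 ` {0..l3} \<inter> N \<noteq> {} \<and>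
          mdist S (exit_point l1 \<gamma>1 N) (entrance_point l2 \<gamma>2 N) \<le> 2 * err \<and>
          mdist S (exit_point l2 \<gamma>2 N) (entrance_point l3 \<gamma>3 N) \<le> 2 * err \<and>
          mdist S (exit_point l3 \<gamma>3 N) (entrance_point l1 \<gamma>1 N) \<le> 2 * err"
    using meets W(1) unfolding N_def Let_def mdist_S by (intro bexI[of _ "pc W"]) auto
qed

lemma hyperbolic_relative_S: "hyperbolic_relative S (pc ` Y)"
  unfolding hyperbolic_relative_def using alpha1_S alpha2_S asymp_tree_graded_S by blast

end

theorem theorem6p3:
  fixes \<xi> :: real
  shows "\<exists>K\<^sub>0::real. \<forall>K\<ge>K\<^sub>0.
    \<forall>(Y :: 'i set) (C :: 'i \<Rightarrow> 'a metric) (p :: 'i \<Rightarrow> 'i \<Rightarrow> 'a set).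
      projection_system Y C p \<and> axiom0 Y C p \<and> axiom3 Y C p \<xi> \<and> axiom4 Y C p \<xi> \<longrightarrow>
        Metric_space (BBF_points Y C p \<xi> K) (BBF_dist Y C p \<xi> K) \<and>
        path_metric (BBF_space Y C p \<xi> K) \<and>
        hyperbolic_relative (BBF_space Y C p \<xi> K) (piece C ` Y)"
proof (intro exI[of _ "12 * max \<xi> 0"] allI impI)
  fix K and Y :: "'i set" and C :: "'i \<Rightarrow> 'a metric" and p
  assume "12 * max \<xi> 0 \<le> K"
    and "projection_system Y C p \<and> axiom0 Y C p \<and> axiom3 Y C p \<xi> \<and> axiom4 Y C p \<xi>"
  then interpret proj_sys Y C p \<xi> K by unfold_locales auto
  show "Metric_space (BBF_points Y C p \<xi> K) (BBF_dist Y C p \<xi> K) \<and>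
        path_metric (BBF_space Y C p \<xi> K) \<and>
        hyperbolic_relative (BBF_space Y C p \<xi> K) (piece C ` Y)"
    using metric_space path_metric_S hyperbolic_relative_S by blast
qed

end
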